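(* Let $(d_n,k_n)_{n\geq 1}$ be a sequence of pairs of positive integers satisfying $k_n < d_n$, $2k_n > d_n+1$ and $d_n \to \infty$ as $n\to\infty$. Let $(0,0,\nu_{d_n,k_n})$ denote the Lévy triplet of $Z_{d_n,k_n}$ and let $\widetilde Z_{n}$ be a random variable with Lévy triplet $(0,0,\nu_{d_n,k_n}/\sigma^2_{d_n,k_n})$. (a) If the codimension $d_n-k_n = b \in \mathbb{N}$ is constant, then $\widetilde Z_n$ converges in distribution to an infinitely divisible random variable $\widetilde Z^{(b)}$ with Lévy triplet $(0,0,\widetilde\nu^{(b)})$, where $$\widetilde\nu^{(b)}(\mathrm{d} x) = \Gamma\bigl(\tfrac{b}{2}\bigr)^{-1} x^{-2} \bigl(-\log x\bigr)^{\frac{b-2}{2}}\;\mathbf 1_{(0,1)}(x)\,\mathrm{d} x.$$ In particular, $\widetilde Z^{(b)}$ has finite moments of all orders and $\mathbb{V}(\widetilde Z^{(b)}) = 1$. (b) If $d_n-k_n \to \infty$, then $\widetilde Z_n$ converges in distribution to a standard Gaussian law.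
   Context: For integers $d,k$ with $1\le k\le d-1$ and $2k>d+1$, $Z_{d,k}$ denotes a real random variable with characteristic function $$\varphi_{Z_{d,k}}(t) = \exp\Big( \int_{\mathbb{R}} (e^{itx}-1-itx) \,\nu_{d,k}(\mathrm{d} x) \Big), \quad t \in \mathbb{R},$$ where the Lévy measure $\nu_{d,k}$ is $$\nu_{d,k}(\mathrm{d} x)=\frac{\omega_{d-k}}{k-1}\;x^{-1-\frac{d-1}{k-1}}\bigl(1-x^{\frac{2}{k-1}}\bigr)^{\frac{d-k}{2}-1}\,\mathbf 1_{(0,1)}(x)\,\mathrm{d} x,$$ and $\omega_b=2\pi^{b/2}/\Gamma(b/2)$ for $b\in\mathbb{N}$. The variance of $Z_{d,k}$ is $\sigma_{d,k}^2 := \mathbb{V}(Z_{d,k}) = \int_{\mathbb{R}} x^2\,\nu_{d,k}(\mathrm{d} x)<\infty$. In this result, a real random variable $X$ with Lévy triplet $(0,0,\nu)$ is an infinitely divisible random variable with characteristic function $\varphi_X(t)=\exp\big(\int_{\mathbb{R}}(e^{itx}-1-itx)\,\nu(\mathrm{d}x)\big)$, $t\in\mathbb{R}$. (In general, the Lévy triplet $(\gamma,a,\nu)$ of $X$ is defined by $\varphi_X(t) = \exp\big( i\gamma t - \frac{1}{2}a t^2 + \int_{\mathbb{R}} ( e^{itx} - 1 - itx\,\mathbf{1}_{\{|x|\le 1\}}) \nu(\mathrm{d} x) \big)$ with $\gamma\in\mathbb{R}$, $a\ge 0$, $\nu(\{0\})=0$ and $\int_{\mathbb{R}} (1 \wedge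 x^2)\,\nu(\mathrm{d} x) < \infty$; all Lévy measures here are concentrated on $(0,1)$, so the two forms agree.) $\log$ denotes the natural logarithm and $\mathbb{V}$ the variance. *)

theory Defs
  imports "HOL-Probability.Probability"
begin

text \<open>Random variables are represented by their laws, i.e. by measures satisfying
  \<^locale>\<open>real_distribution\<close>; all notions below depend on the law only.\<close>

text \<open>The law of a sum of \<open>m\<close> i.i.d. random variables with law \<open>N\<close> is the image of the
  product measure under summation.\<close>

definition infinitely_divisible :: "real measure \<Rightarrow> bool" where
  "infinitely_divisible M \<longleftrightarrow>
     (\<forall>m\<ge>1. \<exists>N. real_distribution N \<and>
        M = distr (Pi\<^sub>M {..<m::nat} (\<lambda>_. N)) borel (\<lambda>x. \<Sum>i<m. x i))"

definition levy_measure :: "real measure \<Rightarrow> bool" where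
  "levy_measure \<nu> \<longleftrightarrow>
     sets \<nu> = sets borel \<and> emeasure \<nu> {0} = 0 \<and>
     (\<integral>\<^sup>+x. ennreal (min 1 (x\<^sup>2)) \<partial>\<nu>) < \<infinity>"

definition has_levy_triplet :: "real measure \<Rightarrow> real \<Rightarrow> real \<Rightarrow> real measure \<Rightarrow> bool" where
  "has_levy_triplet M \<gamma> a \<nu> \<longleftrightarrow>
     real_distribution M \<and> infinitely_divisible M \<and> 0 \<le> a \<and> levy_measure \<nu> \<and>
     (\<forall>t. char M t =
        exp (\<i> * of_real (\<gamma> * t) - of_real (a * t\<^sup>2 / 2) +
             (CLINT x|\<nu>. iexp (t * x) - 1 - \<i> * of_real (t * x * indicator {-1..1} x))))"

text \<open>Surface area of the unit sphere in \<open>b\<close>-dimensional space.\<close>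

definition omega :: "nat \<Rightarrow> real" where
  "omega b = 2 * pi powr (real b / 2) / Gamma (real b / 2)"

definition nu :: "nat \<Rightarrow> nat \<Rightarrow> real measure" where
  "nu d k = density lborel (\<lambda>x. ennreal (
     omega (d - k) / (real k - 1) * x powr (- 1 - (real d - 1) / (real k - 1)) *
     (1 - x powr (2 / (real k - 1))) powr ((real d - real k) / 2 - 1) *
     indicator {0<..<1} x))"

text \<open>No truncation of the compensator: \<open>nu d k\<close> lives on \<open>(0,1)\<close>, so this agrees
  with the triplet \<open>(0,0,nu d k)\<close>.\<close>

definition is_law_Z :: "nat \<Rightarrow> nat \<Rightarrow> real measure \<Rightarrow> bool" where
  "is_law_Z d k M \<longleftrightarrow>
     real_distribution M \<and>
     (\<forall>t. char M t = exp (CLINT x|nu d k. iexp (t * x) - 1 - \<i> * of_real (t * x)))"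

definition nu_lim :: "nat \<Rightarrow> real measure" where
  "nu_lim b = density lborel (\<lambda>x. ennreal (
     1 / Gamma (real b / 2) * x powr (- 2) * (- ln x) powr ((real b - 2) / 2) *
     indicator {0<..<1} x))"

definition law_variance :: "real measure \<Rightarrow> real" where
  "law_variance M = prob_space.variance M (\<lambda>x. x)"

end

theory Submission
  imports Defs "HOL-Complex_Analysis.Cauchy_Integral_Formula" "HOL-Real_Asymp.Real_Asymp"
begin

text \<open>
  All measures \<open>\<nu>\<close> in question live on \<open>(0,1)\<close>, so the Levy exponent is determined by the moments
  \<open>q p\<close> of the finite measure \<open>x\<^sup>2 \<nu>(dx)\<close>: expanding the exponential under the integral gives
  \<open>\<psi>(t) = -t\<^sup>2 (\<Sum>p. (\<i> t)\<^sup>p q p / (p + 2)!)\<close> (\<open>levy_integral_eq_levy_series\<close>). Since \<open>0 \<le> q p \<le> q 0\<close>, this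
  series is entire in \<open>t\<close>, and along a sequence of measures with bounded \<open>q 0\<close> its value converges as soon
  as every \<open>q p\<close> does (\<open>tendsto_levy_series\<close>).
  The limit theorem thus reduces to the convergence of moments.

  For \<open>\<nu> = \<nu>\<^bsub>d,k\<^esub>\<close> put \<open>L = (k - 1) / 2\<close> and \<open>s = (d - k) / 2\<close>. The substitution \<open>x = u\<^sup>L\<close> turns \<open>x\<^sup>2 \<nu>(dx)\<close>
  into a multiple of the Beta density with parameters \<open>L - s\<close> and \<open>s\<close>, so after division by the variance
  \<open>q p = B((p + 1) L - s, s) / B(L - s, s)\<close>. If \<open>s\<close> is fixed and \<open>L \<rightarrow> \<infinity>\<close>, then
  \<open>\<Gamma>(y) / \<Gamma>(y - s) \<sim> y\<^sup>s\<close> gives \<open>q p \<rightarrow> (p + 1)\<^bsup>-s\<^esup>\<close> (\<open>tendsto_beta_moment_fixed\<close>), and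
  these are the moments of \<open>x\<^sup>2\<close> times the limiting Levy measure. If \<open>s \<rightarrow> \<infinity>\<close>, then \<open>q 1 \<le> exp (- s / 4)\<close>,
  hence \<open>q p \<rightarrow> 0\<close> for all \<open>p \<ge> 1\<close> while \<open>q 0 = 1\<close> (\<open>tendsto_beta_moment_gaussian\<close>), and
  the exponent tends to \<open>-t\<^sup>2 / 2\<close>.

  Two further facts are needed. An entire characteristic function forces all moments to be finite, by
  finite differences and Fatou's lemma (\<open>integrable_moment_of_entire_char\<close>); this identifies the
  variance of \<open>Z\<close>, which normalises the Levy measure, gives tightness of the normalised laws, and
  gives the moments of the limit. The limit law itself comes from Helly's
  theorem, and its infinite divisibility from the closedness of infinitely divisible laws under limits
  (\<open>infinitely_divisible_limit\<close>).
\<close>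

section \<open>Finite moments from an entire characteristic function\<close>

definition fdiff :: "'a::ab_group_add \<Rightarrow> ('a \<Rightarrow> 'b::ab_group_add) \<Rightarrow> 'a \<Rightarrow> 'b" where
  "fdiff h f = (\<lambda>t. f (t + h) - f t)"

text \<open>The family \<open>f\<close> lists the successive derivatives of \<open>f 0\<close>. Taking one difference of the whole family
  again gives such a family, bounded by the mean value inequality on a disc whose radius is smaller
  by \<open>norm h\<close>; this makes the induction go through.\<close>

lemma norm_iterated_fdiff_le:
  fixes f :: "nat \<Rightarrow> complex \<Rightarrow> complex"
  assumes "\<And>k z. (f k has_field_derivative f (Suc k) z) (at z)"
    and "\<And>w. norm w \<le> R \<Longrightarrow> norm (f n w) \<le> C"
    and "norm z + real n * norm h \<le> R"
  shows "norm ((fdiff h ^^ n) (f 0) z) \<le> C * norm h ^ n"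
  using assms
proof (induction n arbitrary: f R C)
  case 0
  then show ?case by simp
next
  case (Suc n)
  define g where "g k = fdiff h (f k)" for k
  have "norm ((fdiff h ^^ n) (g 0) z) \<le> (C * norm h) * norm h ^ n"
  proof (rule Suc.IH)
    show "(g k has_field_derivative g (Suc k) w) (at w)" for k w
      using DERIV_shift[of "f k" "f (Suc k) (w + h)" w h] Suc.prems(1)
      by (auto simp: g_def fdiff_def intro!: derivative_eq_intros)
    show "norm (g n w) \<le> C * norm h" if "norm w \<le> R - norm h" for w
    proof -
      have "norm (w + h) \<le> R"
        using that norm_triangle_ineq[of w h] by linarith
      moreover have "norm w \<le> R" using that norm_ge_zero[of h] by linarith
      ultimately have "norm (f n (w + h) - f n w) \<le> C * norm ((w + h) - w)"
        using Suc.prems(1,2)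
        by (intro field_differentiable_bound[where S = "cball 0 R" and f' = "f (Suc n)"])
           (auto intro: has_field_derivative_at_within)
      then show ?thesis by (simp add: g_def fdiff_def)
    qed
    show "norm z + real n * norm h \<le> R - norm h"
      using Suc.prems(3) by (simp add: algebra_simps)
  qed
  moreover have "(fdiff h ^^ Suc n) (f 0) = (fdiff h ^^ n) (g 0)"
    by (simp only: funpow_Suc_right comp_def g_def)
  ultimately show ?case by (simp add: mult_ac)
qed

lemma fdiff_funpow_of_real:
  fixes F :: "complex \<Rightarrow> complex"
  assumes "\<And>t. f t = F (of_real t)"
  shows "(fdiff h ^^ n) f t = (fdiff (of_real h) ^^ n) F (of_real t)"
proof (induction n arbitrary: t)
  case 0 then show ?case using assms by simp
next
  case (Suc n)
  show ?case using Suc[of t] Suc[of "t + h"] by (simp add: fdiff_def)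
qed

text \<open>On a single exponential \<open>exp (\<i> t x)\<close> the difference operator acts as multiplication by
  \<open>exp (\<i> h x) - 1\<close>.\<close>

lemma (in real_distribution) fdiff_char:
  "(fdiff h ^^ n) (char M) t = (CLINT x|M. (iexp (h * x) - 1) ^ n * iexp (t * x))"
proof (induction n arbitrary: t)
  case 0
  then show ?case by (simp add: char_def)
next
  case (Suc n)
  have int: "integrable M (\<lambda>x. (iexp (h * x) - 1) ^ n * iexp (s * x))" for s
  proof (rule integrable_const_bound[where B = "2 ^ n"])
    have "norm (iexp (h * x) - 1) \<le> 2" for x
      using norm_triangle_ineq4[of "iexp (h * x)" 1] by (simp add: norm_exp_i_times)
    then have "norm (iexp (h * x) - 1) ^ n \<le> 2 ^ n" for x
      by (intro power_mono) auto
    then show "AE x in M. norm ((iexp (h * x) - 1) ^ n * iexp (s * x)) \<le> 2 ^ n"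
      by (auto simp: norm_mult norm_power)
  qed auto
  have "(fdiff h ^^ Suc n) (char M) t =
      (CLINT x|M. (iexp (h * x) - 1) ^ n * iexp ((t + h) * x)) -
      (CLINT x|M. (iexp (h * x) - 1) ^ n * iexp (t * x))"
    unfolding funpow.simps comp_def fdiff_def[of h "(fdiff h ^^ n) (char M)"] Suc ..
  also have "\<dots> = (CLINT x|M. (iexp (h * x) - 1) ^ n * iexp ((t + h) * x) -
      (iexp (h * x) - 1) ^ n * iexp (t * x))"
    by (rule Bochner_Integration.integral_diff[symmetric, OF int int])
  also have "\<dots> = (CLINT x|M. (iexp (h * x) - 1) ^ Suc n * iexp (t * x))"
    by (intro Bochner_Integration.integral_cong)
       (auto simp: algebra_simps exp_add)
  finally show ?case .
qed

lemma central_second_difference: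
  "(iexp y - 1)\<^sup>2 * iexp (- y) = complex_of_real (2 * cos y - 2)"
proof -
  have "iexp y * iexp (-y) = 1" by (simp flip: exp_add)
  then have "(iexp y - 1)\<^sup>2 * iexp (- y) = iexp y + iexp (-y) - 2"
    by (simp add: power2_eq_square algebra_simps)
  also have "\<dots> = complex_of_real (2 * cos y - 2)"
    by (simp add: complex_eq_iff Re_exp Im_exp)
  finally show ?thesis .
qed


lemma second_difference_cos_eq: "2 - 2 * cos y = 4 * (sin (y / 2))\<^sup>2" for y :: real
  using cos_double_sin[of "y / 2"] by simp

lemma second_difference_cos_bounds:
  fixes y :: real
  shows "0 \<le> 2 - 2 * cos y" "2 - 2 * cos y \<le> y\<^sup>2"
proof -
  show "0 \<le> 2 - 2 * cos y" by simp
  have "\<bar>sin (y / 2)\<bar> \<le> \<bar>y / 2\<bar>" by (rule abs_sin_x_le_abs_x)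
  then have "(sin (y / 2))\<^sup>2 \<le> (y / 2)\<^sup>2" by (rule abs_le_square_iff[THEN iffD1])
  then show "2 - 2 * cos y \<le> y\<^sup>2"
    unfolding second_difference_cos_eq by (simp add: power_divide)
qed

lemma tendsto_sin_scaled:
  fixes x :: real
  assumes "h \<longlonglongrightarrow> 0" "\<And>n. h n \<noteq> 0"
  shows "(\<lambda>n. sin (h n * x) / h n) \<longlonglongrightarrow> x"
proof (cases "x = 0")
  case False
  have "(\<lambda>n. h n * x) \<longlonglongrightarrow> 0" using tendsto_mult_left_zero[OF assms(1)] by simp
  then have "filterlim (\<lambda>n. h n * x) (at 0) sequentially"
    using False assms(2) by (auto simp: filterlim_at)
  from filterlim_compose[OF sinc_at_0 this]
  have "(\<lambda>n. sin (h n * x) / (h n * x) * x) \<longlonglongrightarrow> 1 * x" by (intro tendsto_intros)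
  moreover have "(\<lambda>n. sin (h n * x) / (h n * x) * x) = (\<lambda>n. sin (h n * x) / h n)"
    using False by (auto simp: field_simps)
  ultimately show ?thesis by simp
qed auto

lemma tendsto_second_difference_cos:
  fixes x :: real
  assumes "h \<longlonglongrightarrow> 0" "\<And>n. h n \<noteq> 0"
  shows "(\<lambda>n. (2 - 2 * cos (h n * x)) / (h n)\<^sup>2) \<longlonglongrightarrow> x\<^sup>2"
proof -
  have "(\<lambda>n. 4 * (sin (h n * (x / 2)) / h n)\<^sup>2) \<longlonglongrightarrow> 4 * (x / 2)\<^sup>2"
    by (intro tendsto_intros tendsto_sin_scaled assms)
  moreover have "4 * (sin (h n * (x / 2)) / h n)\<^sup>2 = (2 - 2 * cos (h n * x)) / (h n)\<^sup>2" for n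
    unfolding second_difference_cos_eq by (simp add: power_divide)
  moreover have "4 * (x / 2)\<^sup>2 = x\<^sup>2" by (simp add: power_divide)
  ultimately show ?thesis by (simp only:)
qed

text \<open>The difference of order \<open>2 m\<close> of the characteristic function, centred at \<open>0\<close>, is up to sign the
  expectation of \<open>(2 - 2 cos (h x))\<^sup>m\<close>. Smoothness bounds it by \<open>C h\<^bsup>2 m\<^esup>\<close>, whereas
  \<open>(2 - 2 cos (h x)) / h\<^sup>2\<close> tends to \<open>x\<^sup>2\<close>; Fatou's lemma bounds the moment.\<close>

lemma (in real_distribution) integrable_even_moment_of_entire_char:
  assumes F: "F holomorphic_on UNIV" and char: "\<And>t. char M t = F (of_real t)"
  shows "integrable M (\<lambda>x. x ^ (2 * m))"
proof (rule integrableI_bounded)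
  define h where "h j = inverse (real (Suc j))" for j
  have h: "h \<longlonglongrightarrow> 0" "\<And>j. h j \<noteq> 0" "\<And>j. 0 < h j" "\<And>j. h j \<le> 1"
    unfolding h_def[abs_def] by (rule LIMSEQ_inverse_real_of_nat) (auto simp: field_simps)
  define f where "f k = (deriv ^^ k) F" for k
  have f: "(f k has_field_derivative f (Suc k) z) (at z)" for k z
    unfolding f_def by (rule has_field_derivative_higher_deriv[OF F]) auto
  \<comment> \<open>Differences of order \<open>2 m\<close> are taken at \<open>- m h\<close> with \<open>h \<le> 1\<close>; \<open>norm_iterated_fdiff_le\<close> then asks for a bound
      on the disc of radius \<open>m + 2 m\<close>.\<close>
  have "continuous_on (cball 0 (3 * real m)) (f (2 * m))"
    using f DERIV_isCont continuous_at_imp_continuous_on by blast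
  then have "compact (f (2 * m) ` cball 0 (3 * real m))"
    by (intro compact_continuous_image) auto
  then obtain C where C: "\<And>w. norm w \<le> 3 * real m \<Longrightarrow> norm (f (2 * m) w) \<le> C"
    by (force dest!: compact_imp_bounded simp: bounded_iff)
  define D where "D j x = ((2 - 2 * cos (h j * x)) / (h j)\<^sup>2) ^ m" for j x
  have D_nonneg: "0 \<le> D j x" for j x
    unfolding D_def using second_difference_cos_bounds(1)[of "h j * x"]
    by (intro zero_le_power divide_nonneg_nonneg zero_le_power2) auto
  have D_int: "integrable M (D j)" for j
  proof (rule integrable_const_bound[where B = "(4 / (h j)\<^sup>2) ^ m"])
    have "D j x \<le> (4 / (h j)\<^sup>2) ^ m" for x
    proof -
      have "2 - 2 * cos (h j * x) \<le> 4"
        using cos_ge_minus_one[of "h j * x"] by linarith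
      then show ?thesis
        using second_difference_cos_bounds(1)[of "h j * x"] unfolding D_def
        by (intro power_mono divide_right_mono divide_nonneg_nonneg zero_le_power2) auto
    qed
    then show "AE x in M. norm (D j x) \<le> (4 / (h j)\<^sup>2) ^ m"
      using D_nonneg by simp
  qed (simp add: D_def[abs_def])
  have D_le: "(LINT x|M. D j x) \<le> C" for j
  proof -
    have "(fdiff (h j) ^^ (2 * m)) (char M) (- real m * h j)
        = (CLINT x|M. complex_of_real ((2 * cos (h j * x) - 2) ^ m))"
      unfolding fdiff_char
    proof (rule Bochner_Integration.integral_cong[OF refl])
      fix x
      have "(iexp (h j * x) - 1) ^ (2 * m) * iexp (- real m * h j * x)
          = ((iexp (h j * x) - 1)\<^sup>2 * iexp (- (h j * x))) ^ m"
        by (simp only: power_mult power_mult_distrib) (simp add: exp_of_nat_mult[symmetric] mult_ac)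
      then show "(iexp (h j * x) - 1) ^ (2 * m) * iexp (- real m * h j * x)
          = complex_of_real ((2 * cos (h j * x) - 2) ^ m)"
        unfolding central_second_difference by simp
    qed
    also have "\<dots> = complex_of_real (LINT x|M. (2 * cos (h j * x) - 2) ^ m)"
      by (rule integral_complex_of_real)
    also have "(LINT x|M. (2 * cos (h j * x) - 2) ^ m)
        = (LINT x|M. (- ((h j)\<^sup>2)) ^ m * D j x)"
    proof (rule Bochner_Integration.integral_cong[OF refl])
      fix x
      have "(- ((h j)\<^sup>2)) ^ m * D j x
          = (- ((h j)\<^sup>2) * ((2 - 2 * cos (h j * x)) / (h j)\<^sup>2)) ^ m"
        by (simp only: D_def power_mult_distrib)
      also have "- ((h j)\<^sup>2) * ((2 - 2 * cos (h j * x)) / (h j)\<^sup>2) = 2 * cos (h j * x) - 2"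
        using h(2)[of j] by (simp add: field_simps)
      finally show "(2 * cos (h j * x) - 2) ^ m = (- ((h j)\<^sup>2)) ^ m * D j x" ..
    qed
    finally have 1: "norm ((fdiff (h j) ^^ (2 * m)) (char M) (- real m * h j))
        = (h j) ^ (2 * m) * \<bar>LINT x|M. D j x\<bar>"
      using h(3)[of j] by (simp add: norm_mult norm_power power_mult abs_mult power_abs)
    have 2: "(fdiff (h j) ^^ (2 * m)) (char M) (- real m * h j)
        = (fdiff (of_real (h j)) ^^ (2 * m)) (f 0) (of_real (- real m * h j))"
      unfolding f_def by (rule fdiff_funpow_of_real) (simp add: char)
    have "norm ((fdiff (of_real (h j)) ^^ (2 * m)) (f 0) (of_real (- real m * h j)))
        \<le> C * norm (complex_of_real (h j)) ^ (2 * m)"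
    proof (rule norm_iterated_fdiff_le[OF f C])
      have "real m * h j \<le> real m * 1" using h(4)[of j] by (intro mult_left_mono) auto
      then show "norm (complex_of_real (- real m * h j))
          + real (2 * m) * norm (complex_of_real (h j)) \<le> 3 * real m"
        using h(3)[of j] by (simp add: norm_mult)
    qed
    then have "(h j) ^ (2 * m) * \<bar>LINT x|M. D j x\<bar> \<le> (h j) ^ (2 * m) * C"
      using h(3)[of j] unfolding 2[symmetric] 1 by (simp add: mult_ac)
    then have "\<bar>LINT x|M. D j x\<bar> \<le> C"
      using h(3)[of j] by (subst (asm) mult_le_cancel_left_pos) auto
    then show ?thesis by linarith
  qed
  have "(\<integral>\<^sup>+x. ennreal (norm (x ^ (2 * m))) \<partial>M) = (\<integral>\<^sup>+x. liminf (\<lambda>j. ennreal (D j x)) \<partial>M)"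
  proof (rule nn_integral_cong)
    fix x
    have "(\<lambda>j. D j x) \<longlonglongrightarrow> (x\<^sup>2) ^ m"
      unfolding D_def by (intro tendsto_intros tendsto_second_difference_cos h)
    then have "(\<lambda>j. ennreal (D j x)) \<longlonglongrightarrow> ennreal (norm (x ^ (2 * m)))"
      by (intro tendsto_ennrealI) (simp add: power_mult)
    then show "ennreal (norm (x ^ (2 * m))) = liminf (\<lambda>j. ennreal (D j x))"
      by (simp add: lim_imp_Liminf)
  qed
  also have "\<dots> \<le> liminf (\<lambda>j. \<integral>\<^sup>+x. ennreal (D j x) \<partial>M)"
    by (rule nn_integral_liminf) (auto simp: D_def)
  also have "\<dots> \<le> ennreal C"
  proof (rule Liminf_le)
    show "\<forall>\<^sub>F j in sequentially. (\<integral>\<^sup>+x. ennreal (D j x) \<partial>M) \<le> ennreal C"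
      using D_le D_nonneg D_int
      by (intro always_eventually allI) (simp add: nn_integral_eq_integral ennreal_leI)
  qed simp
  finally show "(\<integral>\<^sup>+x. ennreal (norm (x ^ (2 * m))) \<partial>M) < \<infinity>"
    by (rule le_less_trans) simp
qed auto

lemma (in real_distribution) integrable_moment_of_entire_char:
  assumes "F holomorphic_on UNIV" "\<And>t. char M t = F (of_real t)"
  shows "integrable M (\<lambda>x. x ^ m)"
proof (rule Bochner_Integration.integrable_bound)
  show "integrable M (\<lambda>x. 1 + x ^ (2 * m))"
    using integrable_even_moment_of_entire_char[OF assms] by simp
  have "\<bar>x ^ m\<bar> \<le> 1 + x ^ (2 * m)" for x :: real
  proof -
    have "2 * \<bar>x ^ m\<bar> \<le> 1 + \<bar>x ^ m\<bar>\<^sup>2"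
      using sum_squares_bound[of "\<bar>x ^ m\<bar>" 1] by simp
    then show ?thesis by (simp add: power_mult[symmetric] mult.commute)
  qed
  then show "AE x in M. norm (x ^ m) \<le> norm (1 + x ^ (2 * m))"
    by (intro AE_I2) (smt (verit) real_norm_def)
qed auto

text \<open>Dominated convergence, applied to \<open>sin (h x) / h\<close> and \<open>(2 - 2 cos (h x)) / h\<^sup>2\<close>. Their expectations are
  \<open>Im \<phi>(h) / h\<close> and \<open>2 (1 - Re \<phi>(h)) / h\<^sup>2\<close> for the characteristic function \<open>\<phi>\<close>.\<close>

lemma (in real_distribution) mean_variance_of_char_expansion:
  assumes int: "integrable M (\<lambda>x. x\<^sup>2)"
    and lim: "((\<lambda>h. (char M h - 1) / (complex_of_real h)\<^sup>2) \<longlongrightarrow> of_real (- v / 2)) (at 0)"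
  shows "expectation (\<lambda>x. x) = 0" "expectation (\<lambda>x. x\<^sup>2) = v"
proof -
  define h where "h j = inverse (real (Suc j))" for j
  have h: "h \<longlonglongrightarrow> 0" "\<And>j. h j \<noteq> 0" "\<And>j. 0 < h j"
    unfolding h_def[abs_def] by (rule LIMSEQ_inverse_real_of_nat) auto
  have "filterlim h (at 0) sequentially"
    using h by (auto simp: filterlim_at)
  from filterlim_compose[OF lim this]
  have Q: "(\<lambda>j. (char M (h j) - 1) / (complex_of_real (h j))\<^sup>2) \<longlonglongrightarrow> of_real (- v / 2)" .
  have int1: "integrable M (\<lambda>x. x)"
    by (rule square_integrable_imp_integrable[OF _ int]) simp
  have intiexp: "integrable M (\<lambda>x. iexp (t * x))" for t
    by (rule integrable_const_bound[where B = 1]) auto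
  have Re: "Re (char M t) = (LINT x|M. cos (t * x))" for t
    unfolding char_def by (subst integral_Re[OF intiexp, symmetric]) (simp add: Re_exp)
  have Im: "Im (char M t) = (LINT x|M. sin (t * x))" for t
    unfolding char_def by (subst integral_Im[OF intiexp, symmetric]) (simp add: Im_exp)
  have intcos: "integrable M (\<lambda>x. cos (t * x))" for t
    by (rule integrable_const_bound[where B = 1]) auto
  have sin_eq: "(LINT x|M. sin (h j * x) / h j)
      = h j * Im ((char M (h j) - 1) / (complex_of_real (h j))\<^sup>2)" for j
  proof -
    have "(LINT x|M. sin (h j * x) / h j) = Im (char M (h j)) / h j"
      unfolding Im by (rule integral_divide_zero)
    also have "\<dots> = h j * (Im (char M (h j) - 1) / (h j)\<^sup>2)"
      using h(2)[of j] by (simp add: power2_eq_square)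
    also have "Im (char M (h j) - 1) / (h j)\<^sup>2 = Im ((char M (h j) - 1) / complex_of_real ((h j)\<^sup>2))"
      by (rule Im_divide_of_real[symmetric])
    finally show ?thesis by (simp only: of_real_power)
  qed
  have cos_eq: "(LINT x|M. (2 - 2 * cos (h j * x)) / (h j)\<^sup>2)
      = - 2 * Re ((char M (h j) - 1) / (complex_of_real (h j))\<^sup>2)" for j
  proof -
    have "(LINT x|M. (2 - 2 * cos (h j * x)) / (h j)\<^sup>2) = (LINT x|M. 2 - 2 * cos (h j * x)) / (h j)\<^sup>2"
      by (rule integral_divide_zero)
    also have "(LINT x|M. 2 - 2 * cos (h j * x)) = 2 - 2 * Re (char M (h j))"
      unfolding Re using intcos[of "h j"] by (simp add: prob_space[unfolded space_eq_univ])
    also have "(2 - 2 * Re (char M (h j))) / (h j)\<^sup>2 = - 2 * (Re (char M (h j) - 1) / (h j)\<^sup>2)"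
      by (simp add: diff_divide_distrib)
    also have "Re (char M (h j) - 1) / (h j)\<^sup>2
        = Re ((char M (h j) - 1) / complex_of_real ((h j)\<^sup>2))"
      by (rule Re_divide_of_real[symmetric])
    finally show ?thesis by (simp only: of_real_power)
  qed
  have "(\<lambda>j. LINT x|M. sin (h j * x) / h j) \<longlonglongrightarrow> (LINT x|M. x)"
  proof (rule integral_dominated_convergence[where w = "\<lambda>x. \<bar>x\<bar>"])
    show "AE x in M. norm (sin (h j * x) / h j) \<le> \<bar>x\<bar>" for j
      using abs_sin_x_le_abs_x[of "h j * x" for x] h(3)[of j]
      by (intro AE_I2) (auto simp: field_simps abs_mult)
    show "AE x in M. (\<lambda>j. sin (h j * x) / h j) \<longlonglongrightarrow> x"
      by (intro AE_I2 tendsto_sin_scaled h)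
    show "integrable M (\<lambda>x. \<bar>x\<bar>)" by (rule integrable_abs[OF int1])
  qed measurable
  from LIMSEQ_unique[OF this[unfolded sin_eq] tendsto_mult[OF h(1) tendsto_Im[OF Q]]]
  show "expectation (\<lambda>x. x) = 0" by simp
  have "(\<lambda>j. LINT x|M. (2 - 2 * cos (h j * x)) / (h j)\<^sup>2) \<longlonglongrightarrow> (LINT x|M. x\<^sup>2)"
  proof (rule integral_dominated_convergence[where w = "\<lambda>x. x\<^sup>2"])
    show "AE x in M. norm ((2 - 2 * cos (h j * x)) / (h j)\<^sup>2) \<le> x\<^sup>2" for j
      using second_difference_cos_bounds[of "h j * x" for x] h(3)[of j]
      by (intro AE_I2) (auto simp: field_simps power_mult_distrib)
    show "AE x in M. (\<lambda>j. (2 - 2 * cos (h j * x)) / (h j)\<^sup>2) \<longlonglongrightarrow> x\<^sup>2"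
      by (intro AE_I2 tendsto_second_difference_cos h)
    show "integrable M (\<lambda>x. x\<^sup>2)" by (rule int)
  qed measurable
  from LIMSEQ_unique[OF this[unfolded cos_eq] tendsto_mult[OF tendsto_const tendsto_Re[OF Q]]]
  show "expectation (\<lambda>x. x\<^sup>2) = v" by simp
qed

section \<open>The Levy exponent as a power series in moments\<close>

text \<open>When \<open>q p\<close> is the moment of order \<open>p\<close> of \<open>x\<^sup>2 \<nu>(dx)\<close>, the Levy exponent of \<open>\<nu>\<close> without Gaussian part and
  with full compensation is \<open>-z\<^sup>2\<close> times this series. Keeping the factor \<open>-z\<^sup>2\<close> outside leaves a
  power series whose coefficients stay bounded even if \<open>\<nu>\<close> is infinite.\<close>

definition levy_series :: "(nat \<Rightarrow> real) \<Rightarrow> complex \<Rightarrow> complex" where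
  "levy_series q z = (\<Sum>p. (\<i> ^ p * of_real (q p) / fact (p + 2)) * z ^ p)"

lemma summable_exp_bound: "summable (\<lambda>p. C * (r ^ p / fact p))" for C r :: real
  using summable_exp_generic[of r] by (intro summable_mult) (simp add: divide_inverse mult.commute)

lemma levy_series_term_le:
  assumes "\<bar>q p\<bar> \<le> C"
  shows "norm ((\<i> ^ p * of_real (q p) / fact (p + 2)) * z ^ p) \<le> C * (norm z ^ p / fact p)"
proof -
  have "norm ((\<i> ^ p * of_real (q p) / fact (p + 2)) * z ^ p)
      = \<bar>q p\<bar> * (norm z ^ p / fact (p + 2))"
    by (simp add: norm_mult norm_divide norm_power norm_fact del: fact_Suc add_2_eq_Suc')
  also have "\<dots> \<le> C * (norm z ^ p / fact p)"
    using assms by (intro mult_mono divide_left_mono fact_mono) auto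
  finally show ?thesis .
qed

lemma summable_levy_series:
  assumes "\<And>p. \<bar>q p\<bar> \<le> C"
  shows "summable (\<lambda>p. (\<i> ^ p * of_real (q p) / fact (p + 2)) * z ^ p)"
  by (rule summable_comparison_test'[OF summable_exp_bound levy_series_term_le[OF assms]])

lemma holomorphic_levy_series:
  assumes "\<And>p. \<bar>q p\<bar> \<le> C"
  shows "levy_series q holomorphic_on A"
proof -
  have "(levy_series q has_field_derivative
      (\<Sum>p. diffs (\<lambda>p. \<i> ^ p * of_real (q p) / fact (p + 2)) p * z ^ p)) (at z)" for z
    unfolding levy_series_def[abs_def]
    by (rule termdiffs_strong_converges_everywhere[OF summable_levy_series[OF assms]])
  then show ?thesis
    by (auto simp: holomorphic_on_def field_differentiable_def intro: has_field_derivative_at_within)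
qed

lemma levy_series_0: "levy_series q 0 = of_real (q 0 / 2)"
  unfolding levy_series_def powser_zero by (simp add: numeral_2_eq_2)

text \<open>Tannery's theorem: the terms are dominated by those of an exponential series.\<close>

lemma tendsto_levy_series:
  assumes "\<And>p. (\<lambda>n. Q n p) \<longlonglongrightarrow> q p" and "\<And>n p. \<bar>Q n p\<bar> \<le> C"
  shows "(\<lambda>n. levy_series (Q n) z) \<longlonglongrightarrow> levy_series q z"
  unfolding levy_series_def
proof (intro tannerys_theorem[THEN conjunct2, THEN conjunct2])
  show "\<forall>\<^sub>F (p, n) in at_top \<times>\<^sub>F sequentially.
      norm ((\<i> ^ p * of_real (Q n p) / fact (p + 2)) * z ^ p) \<le> C * (norm z ^ p / fact p)"
    using levy_series_term_le assms(2) by (intro always_eventually) auto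
  show "(\<lambda>n. (\<i> ^ p * of_real (Q n p) / fact (p + 2)) * z ^ p)
      \<longlonglongrightarrow> (\<i> ^ p * of_real (q p) / fact (p + 2)) * z ^ p" for p
    by (intro tendsto_intros assms(1) fact_nonzero)
  show "summable (\<lambda>p. C * (norm z ^ p / fact p))" by (rule summable_exp_bound)
qed simp

text \<open>The exponent is entire, so all moments exist, and near \<open>0\<close> it equals \<open>-q 0 h\<^sup>2 / 2\<close> up to a term of
  smaller order.\<close>

lemma (in real_distribution) moments_of_levy_series:
  assumes char: "\<And>t. char M t = exp (- (of_real t)\<^sup>2 * levy_series q (of_real t))"
    and bound: "\<And>p. \<bar>q p\<bar> \<le> C"
  shows "integrable M (\<lambda>x. x ^ m)"
    and "expectation (\<lambda>x. x) = 0" and "expectation (\<lambda>x. x\<^sup>2) = q 0"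
proof -
  show int: "integrable M (\<lambda>x. x ^ m)" for m
  proof (rule integrable_moment_of_entire_char[OF _ char])
    show "(\<lambda>z. exp (- z\<^sup>2 * levy_series q z)) holomorphic_on UNIV"
      by (intro holomorphic_intros holomorphic_levy_series[OF bound])
  qed
  \<comment> \<open>\<open>g\<close> is the continuous extension of \<open>(exp w - 1) / w\<close>; it avoids dividing by an exponent that may vanish.\<close>
  obtain g where g: "\<And>w::complex. exp w - exp 0 = g w * (w - 0)" "isCont g 0" "g 0 = 1"
    using CARAT_DERIV[of exp "1 :: complex" 0] DERIV_exp[of "0 :: complex"] by auto
  have "continuous_on UNIV (levy_series q)"
    by (intro holomorphic_on_imp_continuous_on holomorphic_levy_series[OF bound])
  then have "isCont (levy_series q) 0"
    by (simp add: continuous_on_eq_continuous_at)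
  then have S: "((\<lambda>h. levy_series q (of_real h)) \<longlongrightarrow> of_real (q 0 / 2)) (at (0::real))"
    unfolding levy_series_0[symmetric]
    by (rule isCont_tendsto_compose) (auto intro!: tendsto_eq_intros)
  have "((\<lambda>h. - (of_real h)\<^sup>2 * levy_series q (of_real h)) \<longlongrightarrow> 0) (at (0::real))"
    by (rule tendsto_eq_intros S | simp)+
  then have "((\<lambda>h. g (- (of_real h)\<^sup>2 * levy_series q (of_real h))) \<longlongrightarrow> 1) (at (0::real))"
    unfolding g(3)[symmetric] by (rule isCont_tendsto_compose[OF g(2)])
  from tendsto_mult[OF this tendsto_minus[OF S]]
  have "((\<lambda>h. g (- (of_real h)\<^sup>2 * levy_series q (of_real h)) * - levy_series q (of_real h))
      \<longlongrightarrow> of_real (- q 0 / 2)) (at (0::real))" by simp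
  moreover have "\<forall>\<^sub>F h in at (0::real).
      g (- (of_real h)\<^sup>2 * levy_series q (of_real h)) * - levy_series q (of_real h)
      = (char M h - 1) / (complex_of_real h)\<^sup>2"
    unfolding eventually_at_filter
  proof (intro always_eventually allI impI)
    fix h :: real assume "h \<noteq> 0"
    then show "g (- (of_real h)\<^sup>2 * levy_series q (of_real h)) * - levy_series q (of_real h)
        = (char M h - 1) / (complex_of_real h)\<^sup>2"
      using g(1)[of "- (of_real h)\<^sup>2 * levy_series q (of_real h)"] by (simp add: char)
  qed
  ultimately have "((\<lambda>h. (char M h - 1) / (complex_of_real h)\<^sup>2) \<longlongrightarrow> of_real (- q 0 / 2)) (at 0)"
    by (rule Lim_transform_eventually)
  with int[of 2] show "expectation (\<lambda>x. x) = 0" "expectation (\<lambda>x. x\<^sup>2) = q 0"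
    by (auto intro: mean_variance_of_char_expansion)
qed

lemma exp_remainder_sums:
  "(\<lambda>p. z ^ (p + 2) / fact (p + 2)) sums (exp z - 1 - z)" for z :: complex
proof -
  have "(\<lambda>p. z ^ p / fact p) sums exp z"
    using exp_converges[of z] by (simp add: scaleR_conv_of_real divide_inverse mult.commute)
  from sums_split_initial_segment[OF this, of 2] show ?thesis
    by (simp add: numeral_2_eq_2 algebra_simps)
qed

text \<open>Sum and integral may be exchanged because \<open>\<bar>x\<^bsup>p+2\<^esup>\<bar> \<le> x\<^sup>2\<close> on the support of \<open>\<nu>\<close>.\<close>

lemma levy_integral_eq_levy_series:
  fixes \<nu> :: "real measure"
  assumes sets: "sets \<nu> = sets borel" and AE: "AE x in \<nu>. 0 < x \<and> x < 1"
    and int: "integrable \<nu> (\<lambda>x. x\<^sup>2)"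
  shows "(CLINT x|\<nu>. iexp (t * x) - 1 - \<i> * of_real (t * x))
     = - (of_real t)\<^sup>2 * levy_series (\<lambda>p. LINT x|\<nu>. x ^ (p + 2)) (of_real t)"
proof -
  note [measurable_cong] = sets
  have AE_pow: "AE x in \<nu>. \<bar>x ^ (p + 2)\<bar> \<le> x\<^sup>2" for p
    using AE
  proof eventually_elim
    case (elim x)
    then have "x ^ p * x\<^sup>2 \<le> 1 * x\<^sup>2" by (intro mult_right_mono power_le_one) auto
    with elim show ?case by (simp only: power_add abs_mult) (simp add: power_abs[symmetric])
  qed
  have intp: "integrable \<nu> (\<lambda>x. x ^ (p + 2))" for p
    by (rule Bochner_Integration.integrable_bound[OF int]) (use AE_pow in auto)
  define f where "f p x = (\<i> * of_real (t * x)) ^ (p + 2) / fact (p + 2)" for p x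
  have f_eq: "f p x = (\<i> * of_real t) ^ (p + 2) / fact (p + 2) * of_real (x ^ (p + 2))" for p x
    by (simp add: f_def power_mult_distrib)
  have f_norm: "norm (f p x) = \<bar>t\<bar> ^ (p + 2) / fact (p + 2) * \<bar>x ^ (p + 2)\<bar>" for p x
    by (simp add: f_eq norm_mult norm_divide norm_power power_abs norm_fact
        del: fact_Suc add_2_eq_Suc' power_Suc)
  have f_int: "integrable \<nu> (f p)" for p
    unfolding f_eq[abs_def] by (intro integrable_mult_right integrable_of_real intp)
  have sumt: "summable (\<lambda>p. \<bar>t\<bar> ^ (p + 2) / fact (p + 2))"
    using summable_exp_bound[of 1 "\<bar>t\<bar>"] by (subst summable_iff_shift) simp
  have "(\<lambda>p. CLINT x|\<nu>. f p x) sums (CLINT x|\<nu>. \<Sum>p. f p x)"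
  proof (rule sums_integral)
    show "AE x in \<nu>. summable (\<lambda>p. norm (f p x))"
      using AE_pow[of 0]
    proof (rule AE_mp, intro AE_I2 impI)
      fix x
      show "summable (\<lambda>p. norm (f p x))"
        using summable_exp_bound[of 1 "\<bar>t * x\<bar>"] unfolding f_def
        by (subst summable_iff_shift[of "\<lambda>p. norm ((\<i> * of_real (t * x)) ^ p / fact p)"])
           (simp add: norm_divide norm_power norm_mult abs_mult)
    qed
    show "summable (\<lambda>p. LINT x|\<nu>. norm (f p x))"
    proof (rule summable_comparison_test'[OF summable_mult2[OF sumt]])
      fix p
      have "(LINT x|\<nu>. norm (f p x)) \<le> (LINT x|\<nu>. \<bar>t\<bar> ^ (p + 2) / fact (p + 2) * x\<^sup>2)"
        unfolding f_norm
      proof (intro integral_mono_AE integrable_mult_right integrable_abs intp int)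
        show "AE x in \<nu>. \<bar>t\<bar> ^ (p + 2) / fact (p + 2) * \<bar>x ^ (p + 2)\<bar>
            \<le> \<bar>t\<bar> ^ (p + 2) / fact (p + 2) * x\<^sup>2"
          using AE_pow[of p] by eventually_elim (intro mult_left_mono, auto)
      qed
      then show "norm (LINT x|\<nu>. norm (f p x))
          \<le> \<bar>t\<bar> ^ (p + 2) / fact (p + 2) * (LINT x|\<nu>. x\<^sup>2)"
        by simp
    qed
  qed (rule f_int)
  also have "(\<lambda>x. \<Sum>p. f p x) = (\<lambda>x. iexp (t * x) - 1 - \<i> * of_real (t * x))"
    unfolding f_def by (intro ext sums_unique[symmetric] exp_remainder_sums)
  finally have "(CLINT x|\<nu>. iexp (t * x) - 1 - \<i> * of_real (t * x)) = (\<Sum>p. CLINT x|\<nu>. f p x)"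
    by (rule sums_unique)
  also have "\<dots> = (\<Sum>p. - (of_real t)\<^sup>2
      * ((\<i> ^ p * of_real (LINT x|\<nu>. x ^ (p + 2)) / fact (p + 2)) * of_real t ^ p))"
  proof (intro arg_cong[where f = suminf] ext)
    fix p
    have "(CLINT x|\<nu>. f p x)
        = (\<i> * of_real t) ^ (p + 2) / fact (p + 2) * of_real (LINT x|\<nu>. x ^ (p + 2))"
      unfolding f_eq integral_mult_right_zero integral_complex_of_real ..
    moreover have "(\<i> * complex_of_real t) ^ (p + 2) = - (of_real t)\<^sup>2 * (\<i> ^ p * of_real t ^ p)"
      unfolding power_add power_mult_distrib by simp
    ultimately show "(CLINT x|\<nu>. f p x) = - (of_real t)\<^sup>2
        * ((\<i> ^ p * of_real (LINT x|\<nu>. x ^ (p + 2)) / fact (p + 2)) * of_real t ^ p)"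
      by (simp only: times_divide_eq_left times_divide_eq_right mult.assoc mult.commute mult.left_commute)
  qed
  also have "\<dots> = - (of_real t)\<^sup>2 * levy_series (\<lambda>p. LINT x|\<nu>. x ^ (p + 2)) (of_real t)"
    unfolding levy_series_def
  proof (rule suminf_mult)
    have "\<bar>LINT x|\<nu>. x ^ (p + 2)\<bar> \<le> (LINT x|\<nu>. x\<^sup>2)" for p
    proof -
      have "\<bar>LINT x|\<nu>. x ^ (p + 2)\<bar> \<le> (LINT x|\<nu>. \<bar>x ^ (p + 2)\<bar>)"
        by (rule integral_abs_bound)
      also have "\<dots> \<le> (LINT x|\<nu>. x\<^sup>2)"
        by (intro integral_mono_AE integrable_abs intp int AE_pow)
      finally show ?thesis .
    qed
    then show "summable (\<lambda>p. (\<i> ^ p * of_real (LINT x|\<nu>. x ^ (p + 2)) / fact (p + 2)) * of_real t ^ p)"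
      by (rule summable_levy_series)
  qed
  finally show ?thesis .
qed

section \<open>Limits of infinitely divisible laws\<close>

lemma prob_space_PiM_real_distribution:
  "real_distribution N \<Longrightarrow> prob_space (Pi\<^sub>M I (\<lambda>_. N))"
  by (intro prob_space_PiM) (simp add: real_distribution_def)

lemma real_distribution_distr_sum:
  assumes "real_distribution N"
  shows "real_distribution (distr (Pi\<^sub>M {..<m::nat} (\<lambda>_. N)) borel (\<lambda>x. \<Sum>i<m. x i))"
proof -
  interpret N: real_distribution N by (rule assms)
  interpret P: prob_space "Pi\<^sub>M {..<m} (\<lambda>_. N)"
    by (rule prob_space_PiM_real_distribution[OF assms])
  have [measurable_cong]: "sets N = sets borel" by simp
  have sum_meas: "(\<lambda>x. \<Sum>i<m. x i) \<in> borel_measurable (Pi\<^sub>M {..<m} (\<lambda>_. N))" by measurable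
  show ?thesis
    by (rule P.real_distribution_distr[OF sum_meas])
qed

lemma char_distr_sum_iid:
  assumes "real_distribution N"
  shows "char (distr (Pi\<^sub>M {..<m::nat} (\<lambda>_. N)) borel (\<lambda>x. \<Sum>i<m. x i)) t = char N t ^ m"
proof -
  interpret N: real_distribution N by (rule assms)
  interpret P: prob_space "Pi\<^sub>M {..<m} (\<lambda>_. N)"
    by (rule prob_space_PiM_real_distribution[OF assms])
  interpret PS: product_sigma_finite "\<lambda>_. N"
    by standard
  have [measurable_cong]: "sets N = sets borel" by simp
  have sum_meas: "(\<lambda>x. \<Sum>i<m. x i) \<in> borel_measurable (Pi\<^sub>M {..<m} (\<lambda>_. N))" by measurable
  have "char (distr (Pi\<^sub>M {..<m} (\<lambda>_. N)) borel (\<lambda>x. \<Sum>i<m. x i)) t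
      = (CLINT x|Pi\<^sub>M {..<m} (\<lambda>_. N). iexp (t * (\<Sum>i<m. x i)))"
    unfolding char_def by (rule integral_distr[OF sum_meas]) simp
  also have "\<dots> = (CLINT x|Pi\<^sub>M {..<m} (\<lambda>_. N). \<Prod>i<m. iexp (t * x i))"
    by (simp add: sum_distrib_left exp_sum)
  also have "\<dots> = (\<Prod>i<m. CLINT y|N. iexp (t * y))"
    by (rule PS.product_integral_prod) (auto intro!: N.integrable_const_bound[where B = 1])
  finally show ?thesis by (simp add: char_def)
qed

text \<open>If all \<open>m\<close> independent summands lie in \<open>A\<close>, which has probability \<open>N(A)\<^sup>m\<close>, then their sum lies in \<open>B\<close>.
  This transfers tail bounds from the sum back to one summand.\<close>

lemma iid_tail_power_le:
  assumes "real_distribution N" and B: "B \<in> sets borel"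
    and sub: "\<And>x. (\<forall>i<m. x i \<in> A) \<Longrightarrow> (\<Sum>i<m. x i) \<in> B" and A: "A \<in> sets borel"
  shows "measure N A ^ m \<le> measure (distr (Pi\<^sub>M {..<m::nat} (\<lambda>_. N)) borel (\<lambda>x. \<Sum>i<m. x i)) B"
proof -
  interpret N: real_distribution N by (rule assms)
  interpret P: prob_space "Pi\<^sub>M {..<m} (\<lambda>_. N)"
    by (rule prob_space_PiM_real_distribution[OF assms(1)])
  interpret PS: finite_product_prob_space "\<lambda>_. N" "{..<m}"
    by standard (auto simp: N.prob_space)
  have [measurable_cong]: "sets N = sets borel" by simp
  have sum_meas: "(\<lambda>x. \<Sum>i<m. x i) \<in> borel_measurable (Pi\<^sub>M {..<m} (\<lambda>_. N))" by measurable
  have "measure N A ^ m = measure (Pi\<^sub>M {..<m} (\<lambda>_. N)) (Pi\<^sub>E {..<m} (\<lambda>_. A))"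
    using A by (subst PS.finite_measure_PiM_emb) auto
  also have "\<dots> \<le> measure (Pi\<^sub>M {..<m} (\<lambda>_. N))
      ((\<lambda>x. \<Sum>i<m. x i) -` B \<inter> space (Pi\<^sub>M {..<m} (\<lambda>_. N)))"
  proof (rule P.finite_measure_mono)
    show "Pi\<^sub>E {..<m} (\<lambda>_. A) \<subseteq> (\<lambda>x. \<Sum>i<m. x i) -` B \<inter> space (Pi\<^sub>M {..<m} (\<lambda>_. N))"
      using sub by (auto simp: space_PiM PiE_iff)
    show "(\<lambda>x. \<Sum>i<m. x i) -` B \<inter> space (Pi\<^sub>M {..<m} (\<lambda>_. N)) \<in> sets (Pi\<^sub>M {..<m} (\<lambda>_. N))"
      by (rule measurable_sets[OF sum_meas B])
  qed
  also have "\<dots> = measure (distr (Pi\<^sub>M {..<m} (\<lambda>_. N)) borel (\<lambda>x. \<Sum>i<m. x i)) B"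
    by (rule measure_distr[OF sum_meas B, symmetric])
  finally show ?thesis .
qed

lemma (in real_distribution) measure_interval_ge:
  "1 - measure M {..a} - measure M {b<..} \<le> measure M {a<..b}"
proof -
  have "1 = measure M ({..a} \<union> {a<..b} \<union> {b<..})"
  proof -
    have "{..a} \<union> {a<..b} \<union> {b<..} = space M" by auto
    then show ?thesis using prob_space by simp
  qed
  also have "\<dots> \<le> measure M ({..a} \<union> {a<..b}) + measure M {b<..}"
    by (rule measure_Un_le) auto
  also have "measure M ({..a} \<union> {a<..b}) \<le> measure M {..a} + measure M {a<..b}"
    by (rule measure_Un_le) auto
  finally show ?thesis by simp
qed

text \<open>If every summand exceeds \<open>K\<close> then so does the sum, and likewise below \<open>-K\<close>. Hence each tail of a
  summand is at most the \<open>m\<close>-th root of a tail of the sum.\<close>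

lemma tight_iid_summands:
  assumes tight: "tight M" and m: "m \<ge> 1"
    and N: "\<And>n. real_distribution (N n)"
    and M: "\<And>n. M n = distr (Pi\<^sub>M {..<m::nat} (\<lambda>_. N n)) borel (\<lambda>x. \<Sum>i<m. x i)"
  shows "tight N"
  unfolding tight_def
proof (intro conjI allI impI N)
  fix \<epsilon> :: real assume \<epsilon>: "\<epsilon> > 0"
  define \<delta> where "\<delta> = (\<epsilon> / 3) ^ m"
  have "\<delta> > 0" using \<epsilon> by (simp add: \<delta>_def)
  with tight obtain a b where ab: "a < b" "\<And>n. 1 - \<delta> < measure (M n) {a<..b}"
    unfolding tight_def by blast
  define K where "K = max \<bar>a\<bar> \<bar>b\<bar> + 1"
  have K: "- K < a" "b < K" "K \<ge> 1" by (auto simp: K_def)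
  have tail: "measure (N n) A \<le> \<epsilon> / 3"
    if A: "A \<in> sets borel" and sub: "\<And>x. (\<forall>i<m. x i \<in> A) \<Longrightarrow> (\<Sum>i<m. x i) \<in> - {a<..b}" for n A
  proof -
    interpret M: real_distribution "M n" using tight by (simp add: tight_def)
    have "measure (N n) A ^ m \<le> measure (M n) (- {a<..b})"
      unfolding M by (rule iid_tail_power_le[OF N _ sub A]) auto
    also have "\<dots> = 1 - measure (M n) {a<..b}"
      using M.prob_compl[of "{a<..b}"] by (simp add: Compl_eq_Diff_UNIV)
    also have "\<dots> \<le> \<delta>" using ab(2)[of n] by simp
    finally show ?thesis
      unfolding \<delta>_def using \<epsilon> m by (subst (asm) power_mono_iff) auto
  qed
  have sums: "K \<le> real m * K" using K m by (simp add: mult_le_cancel_right1)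
  have "1 - \<epsilon> < measure (N n) {-K<..K}" for n
  proof -
    interpret N: real_distribution "N n" by (rule N)
    have "measure (N n) {K<..} \<le> \<epsilon> / 3"
    proof (rule tail)
      fix x :: "nat \<Rightarrow> real" assume "\<forall>i<m. x i \<in> {K<..}"
      then have "(\<Sum>i<m. K) \<le> (\<Sum>i<m. x i)" by (intro sum_mono) auto
      then have "real m * K \<le> (\<Sum>i<m. x i)" by simp
      with sums have "K \<le> (\<Sum>i<m. x i)" by (rule order_trans)
      with K show "(\<Sum>i<m. x i) \<in> - {a<..b}" by auto
    qed auto
    moreover have "measure (N n) {..-K} \<le> \<epsilon> / 3"
    proof (rule tail)
      fix x :: "nat \<Rightarrow> real" assume "\<forall>i<m. x i \<in> {..-K}"
      then have "(\<Sum>i<m. x i) \<le> (\<Sum>i<m. - K)" by (intro sum_mono) auto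
      then have "(\<Sum>i<m. x i) \<le> - (real m * K)" by simp
      also have "\<dots> \<le> - K" using sums by (rule le_imp_neg_le)
      finally show "(\<Sum>i<m. x i) \<in> - {a<..b}" using K by auto
    qed auto
    ultimately show ?thesis using N.measure_interval_ge[of "- K" K] \<epsilon> by linarith
  qed
  moreover have "- K < K" using K by simp
  ultimately show "\<exists>a b. a < b \<and> (\<forall>n. 1 - \<epsilon> < measure (N n) {a<..b})" by blast
qed

text \<open>For each \<open>m\<close> the laws of the summands are tight, so a subsequence of them converges; the \<open>m\<close>-th power of the limiting
  characteristic function is that of \<open>M'\<close>.\<close>

lemma infinitely_divisible_limit:
  assumes tight: "tight M" and ID: "\<And>n. infinitely_divisible (M n)"
    and M': "real_distribution M'" and lim: "\<And>t. (\<lambda>n. char (M n) t) \<longlonglongrightarrow> char M' t"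
  shows "infinitely_divisible M'"
  unfolding infinitely_divisible_def
proof (intro allI impI)
  fix m :: nat assume m: "1 \<le> m"
  have "\<forall>n. \<exists>N. real_distribution N \<and>
      M n = distr (Pi\<^sub>M {..<m} (\<lambda>_. N)) borel (\<lambda>x. \<Sum>i<m. x i)"
    using ID m unfolding infinitely_divisible_def by blast
  from choice[OF this] obtain N where N: "\<And>n. real_distribution (N n)"
    "\<And>n. M n = distr (Pi\<^sub>M {..<m} (\<lambda>_. N n)) borel (\<lambda>x. \<Sum>i<m. x i)"
    by blast
  have "tight N" by (rule tight_iid_summands[OF tight m N])
  from tight_imp_convergent_subsubsequence[OF this strict_mono_id]
  obtain r N' where r: "strict_mono (r :: nat \<Rightarrow> nat)" and N': "real_distribution N'"
    and conv: "weak_conv_m (\<lambda>n. N (r n)) N'" by (auto simp: comp_def)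
  have "(\<lambda>n. char (N (r n)) t ^ m) \<longlonglongrightarrow> char N' t ^ m" for t
    by (intro tendsto_power levy_continuity1 N N' conv)
  moreover have "(\<lambda>n. char (N (r n)) t ^ m) = (\<lambda>n. char (M n) t) \<circ> r" for t
    by (simp add: fun_eq_iff N(2) char_distr_sum_iid[OF N(1)])
  ultimately have "char N' t ^ m = char M' t" for t
    using LIMSEQ_subseq_LIMSEQ[OF lim r] LIMSEQ_unique by metis
  then have "M' = distr (Pi\<^sub>M {..<m} (\<lambda>_. N')) borel (\<lambda>x. \<Sum>i<m. x i)"
    by (intro Levy_uniqueness M' real_distribution_distr_sum N' ext)
       (simp add: char_distr_sum_iid[OF N'])
  with N' show "\<exists>N. real_distribution N \<and>
      M' = distr (Pi\<^sub>M {..<m} (\<lambda>_. N)) borel (\<lambda>x. \<Sum>i<m. x i)" by blast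
qed

lemma tight_char_limit_is_char:
  assumes tight: "tight M" and lim: "\<And>t. (\<lambda>n. char (M n) t) \<longlonglongrightarrow> f t"
  shows "\<exists>M'. real_distribution M' \<and> char M' = f"
proof -
  have rd: "real_distribution (M n)" for n using tight by (simp add: tight_def)
  from tight_imp_convergent_subsubsequence[OF tight strict_mono_id]
  obtain r M' where r: "strict_mono (r :: nat \<Rightarrow> nat)" and M': "real_distribution M'"
    and conv: "weak_conv_m (\<lambda>n. M (r n)) M'" by (auto simp: comp_def)
  have "(\<lambda>n. char (M (r n)) t) \<longlonglongrightarrow> char M' t" for t
    by (rule levy_continuity1[OF rd M' conv])
  moreover have "(\<lambda>n. char (M (r n)) t) \<longlonglongrightarrow> f t" for t
    using LIMSEQ_subseq_LIMSEQ[OF lim r] by (simp add: comp_def)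
  ultimately have "char M' = f" using LIMSEQ_unique by blast
  with M' show ?thesis by blast
qed

lemma tight_of_second_moments:
  assumes rd: "\<And>n. real_distribution (M n)"
    and int: "\<And>n. integrable (M n) (\<lambda>x. x\<^sup>2)" and bound: "\<And>n. (LINT x|M n. x\<^sup>2) \<le> c"
  shows "tight M"
  unfolding tight_def
proof (intro conjI allI impI rd)
  fix \<epsilon> :: real assume \<epsilon>: "\<epsilon> > 0"
  define K where "K = sqrt ((\<bar>c\<bar> + 1) * 2 / \<epsilon>)"
  have "(\<bar>c\<bar> + 1) * 2 / \<epsilon> > 0" using \<epsilon> by (intro divide_pos_pos) auto
  then have K: "K > 0" "K\<^sup>2 = (\<bar>c\<bar> + 1) * 2 / \<epsilon>" unfolding K_def by auto
  have "1 - \<epsilon> < measure (M n) {-K<..K}" for n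
  proof -
    interpret real_distribution "M n" by (rule rd)
    have "measure (M n) {x \<in> space (M n). K\<^sup>2 \<le> x\<^sup>2} \<le> (LINT x|M n. x\<^sup>2) / K\<^sup>2"
      by (rule integral_Markov_inequality_measure[where A = "{}", OF int]) (use K(1) in auto)
    also have "\<dots> \<le> \<bar>c\<bar> / K\<^sup>2" using bound[of n] by (intro divide_right_mono) auto
    also have "\<dots> < \<epsilon>"
    proof -
      have "\<epsilon> * K\<^sup>2 = (\<bar>c\<bar> + 1) * 2" using \<epsilon> unfolding K(2) by simp
      then have "\<bar>c\<bar> < \<epsilon> * K\<^sup>2" by simp
      then show ?thesis using K(1) by (simp add: pos_divide_less_eq)
    qed
    finally have *: "measure (M n) {x. K\<^sup>2 \<le> x\<^sup>2} < \<epsilon>" by simp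
    have "1 - measure (M n) {x. K\<^sup>2 \<le> x\<^sup>2} = measure (M n) (- {x. K\<^sup>2 \<le> x\<^sup>2})"
      using prob_compl[of "{x. K\<^sup>2 \<le> x\<^sup>2}"] by (simp add: Compl_eq_Diff_UNIV)
    also have "\<dots> \<le> measure (M n) {-K<..K}"
    proof (rule finite_measure_mono)
      show "- {x. K\<^sup>2 \<le> x\<^sup>2} \<subseteq> {-K<..K}"
        using K(1) abs_le_square_iff[of K] by (force simp: not_le)
    qed simp
    finally show ?thesis using * by linarith
  qed
  moreover have "- K < K" using K by simp
  ultimately show "\<exists>a b. a < b \<and> (\<forall>n. 1 - \<epsilon> < measure (M n) {a<..b})" by blast
qed

section \<open>Levy densities on the unit interval\<close>

lemma has_integral_substitution_nonneg:
  fixes f g g' :: "real \<Rightarrow> real"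
  assumes S: "S \<in> sets lebesgue"
    and der: "\<And>x. x \<in> S \<Longrightarrow> (g has_field_derivative g' x) (at x within S)"
    and inj: "inj_on g S" and nonneg: "\<And>x. x \<in> S \<Longrightarrow> 0 \<le> f (g x)"
    and int: "((\<lambda>x. \<bar>g' x\<bar> * f (g x)) has_integral I) S"
  shows "(f has_integral I) (g ` S)"
proof -
  have "(\<lambda>x. \<bar>g' x\<bar> * f (g x)) absolutely_integrable_on S"
    using int nonneg by (intro nonnegative_absolutely_integrable_1) (auto simp: integrable_on_def)
  with int have "f absolutely_integrable_on g ` S \<and> integral (g ` S) f = I"
    by (subst has_absolute_integral_change_of_variables_1'[OF S der inj, symmetric])
       (auto simp: integral_unique)
  then show ?thesis
    by (auto simp: absolutely_integrable_on_def has_integral_integral)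
qed

text \<open>The Beta integral after the substitution \<open>x = u\<^sup>L\<close>.\<close>

lemma has_integral_Beta_root:
  fixes \<alpha> s L :: real
  assumes "\<alpha> > 0" "s > 0" "L > 0"
  shows "((\<lambda>x. x powr (\<alpha> / L - 1) * (1 - x powr (1 / L)) powr (s - 1))
           has_integral L * Beta \<alpha> s) {0<..<1}"
proof -
  have less_one: "x powr r < 1" if "0 < x" "x < 1" "0 < r" for x r :: real
    using powr_less_mono2[of r x 1] that by simp
  define f where "f x = x powr (\<alpha> / L - 1) * (1 - x powr (1 / L)) powr (s - 1)" for x :: real
  have img: "(\<lambda>u. u powr L) ` {0<..<1} = {0<..<1::real}"
  proof (intro equalityI subsetI)
    fix x :: real assume x: "x \<in> {0<..<1}"
    then have "x = (x powr (1 / L)) powr L" using assms by (simp add: powr_powr)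
    moreover have "x powr (1 / L) \<in> {0<..<1}" using x assms by (auto intro: less_one)
    ultimately show "x \<in> (\<lambda>u. u powr L) ` {0<..<1}" by (rule image_eqI)
  qed (use assms in \<open>auto intro: less_one\<close>)
  have "(f has_integral L * Beta \<alpha> s) ((\<lambda>u. u powr L) ` {0<..<1})"
  proof (rule has_integral_substitution_nonneg[where g' = "\<lambda>u. L * u powr (L - 1)"])
    show "((\<lambda>u. u powr L) has_real_derivative L * u powr (L - 1)) (at u within {0<..<1})"
      if "u \<in> {0<..<1}" for u
      using that by (intro has_field_derivative_at_within[OF has_real_derivative_powr]) auto
    show "inj_on (\<lambda>u. u powr L) {0<..<1}"
      using assms by (intro inj_on_inverseI[where g = "\<lambda>x. x powr (1 / L)"]) (simp add: powr_powr)
    have "((\<lambda>u. L * (u powr (\<alpha> - 1) * (1 - u) powr (s - 1))) has_integral L * Beta \<alpha> s) {0<..<1}"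
      using has_integral_Beta_real[of \<alpha> s] assms
      by (intro has_integral_mult_right) (simp add: has_integral_Icc_iff_Ioo)
    moreover have "L * (u powr (\<alpha> - 1) * (1 - u) powr (s - 1)) = \<bar>L * u powr (L - 1)\<bar> * f (u powr L)"
      if "u \<in> {0<..<1}" for u
    proof -
      have "u powr (L - 1) * u powr (L * (\<alpha> / L - 1)) = u powr (\<alpha> - 1)"
        using assms by (simp flip: powr_add add: right_diff_distrib)
      then show ?thesis
        using that assms by (simp add: f_def powr_powr abs_mult)
    qed
    ultimately show "((\<lambda>u. \<bar>L * u powr (L - 1)\<bar> * f (u powr L)) has_integral L * Beta \<alpha> s) {0<..<1}"
      by (subst has_integral_cong[where g = "\<lambda>u. L * (u powr (\<alpha> - 1) * (1 - u) powr (s - 1))"]) auto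
  qed (auto simp: f_def)
  then show ?thesis by (simp add: img f_def[abs_def])
qed

text \<open>The Gamma integral after the substitution \<open>x = exp (- y / q)\<close>.\<close>

lemma has_integral_Gamma_log:
  fixes s q :: real
  assumes "s > 0" "q > 0"
  shows "((\<lambda>x. x powr (q - 1) * (- ln x) powr (s - 1)) has_integral Gamma s * q powr (- s)) {0<..<1}"
proof -
  define f where "f x = x powr (q - 1) * (- ln x) powr (s - 1)" for x :: real
  define g where "g y = exp (- y / q)" for y
  have img: "g ` {0<..} = {0<..<1::real}"
  proof (intro equalityI subsetI)
    fix x :: real assume x: "x \<in> {0<..<1}"
    then have "x = g (- q * ln x)" "- q * ln x \<in> {0<..}"
      using assms by (auto simp: g_def mult_pos_neg)
    then show "x \<in> g ` {0<..}" by (rule image_eqI)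
  qed (use assms in \<open>auto simp: g_def\<close>)
  have "(f has_integral Gamma s * q powr (- s)) (g ` {0<..})"
  proof (rule has_integral_substitution_nonneg[where g' = "\<lambda>y. - exp (- y / q) / q"])
    show "(g has_real_derivative - exp (- y / q) / q) (at y within {0<..})" for y
      unfolding g_def[abs_def] using assms by (auto intro!: derivative_eq_intros)
    show "inj_on g {0<..}" using assms by (auto simp: g_def inj_on_def)
    have "((\<lambda>t. t powr (s - 1) / exp t) has_integral Gamma s) {0<..}"
      using Gamma_integral_real[OF assms(1)]
      by (rule has_integral_spike_set_eq[THEN iffD1, rotated 2])
         (auto intro: negligible_subset[of "{0}"])
    then have "((\<lambda>t. q powr (- s) * (t powr (s - 1) / exp t)) has_integral q powr (- s) * Gamma s) {0<..}"
      by (rule has_integral_mult_right)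
    moreover have "q powr (- s) * (y powr (s - 1) / exp y) = \<bar>- exp (- y / q) / q\<bar> * f (g y)"
      if "y \<in> {0<..}" for y
    proof -
      have "f (g y) = exp (- y / q * (q - 1)) * (y powr (s - 1) / q powr (s - 1))"
        using that assms by (simp add: f_def g_def powr_def[of "exp _"] powr_divide mult.commute)
      moreover have "\<bar>- exp (- y / q) / q\<bar> = exp (- y / q) / q"
        using assms by simp
      ultimately have "\<bar>- exp (- y / q) / q\<bar> * f (g y)
          = (exp (- y / q) * exp (- y / q * (q - 1))) * y powr (s - 1) / (q * q powr (s - 1))"
        by simp
      also have "exp (- y / q) * exp (- y / q * (q - 1)) = exp (- y)"
        using assms by (simp flip: exp_add add: field_simps)
      also have "q * q powr (s - 1) = q powr s"
        using assms by (simp add: powr_mult_base)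
      finally show ?thesis
        by (simp add: powr_minus_divide exp_minus divide_inverse mult_ac)
    qed
    ultimately show "((\<lambda>y. \<bar>- exp (- y / q) / q\<bar> * f (g y)) has_integral Gamma s * q powr (- s)) {0<..}"
      by (subst has_integral_cong[where g = "\<lambda>t. q powr (- s) * (t powr (s - 1) / exp t)"])
         (auto simp: mult.commute)
  qed (auto simp: f_def)
  then show ?thesis by (simp add: img f_def[abs_def])
qed

definition unit_density :: "(real \<Rightarrow> real) \<Rightarrow> real measure" where
  "unit_density w = density lborel (\<lambda>x. ennreal (w x * indicator {0<..<1} x))"

lemma sets_unit_density [simp]: "sets (unit_density w) = sets borel"
  by (simp add: unit_density_def)

lemma AE_unit_density:
  assumes [measurable]: "w \<in> borel_measurable borel"
  shows "AE x in unit_density w. 0 < x \<and> x < 1"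
  unfolding unit_density_def by (subst AE_density) (auto simp: indicator_def)

lemma unit_density_moment:
  assumes [measurable]: "w \<in> borel_measurable borel"
    and nonneg: "\<And>x. 0 < x \<Longrightarrow> x < 1 \<Longrightarrow> 0 \<le> w x"
    and int: "((\<lambda>x. x ^ p * w x) has_integral r) {0<..<1}"
  shows "has_bochner_integral (unit_density w) (\<lambda>x. x ^ p) r"
  unfolding unit_density_def
proof (rule has_bochner_integral_density)
  show "has_bochner_integral lborel (\<lambda>x. (w x * indicator {0<..<1} x) *\<^sub>R x ^ p) r"
  proof (rule has_bochner_integral_nn_integral)
    show pos: "AE x in lborel. 0 \<le> (w x * indicator {0<..<1} x) *\<^sub>R x ^ p"
      using nonneg by (auto simp: indicator_def)
    show "0 \<le> r" by (rule has_integral_nonneg[OF int]) (use nonneg in auto)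
    have "((\<lambda>x. (w x * indicator {0<..<1} x) *\<^sub>R x ^ p) has_integral r) UNIV"
      using int by (subst (asm) has_integral_restrict_UNIV[symmetric])
        (auto elim!: has_integral_eq[rotated] simp: indicator_def)
    then show "(\<integral>\<^sup>+x. ennreal ((w x * indicator {0<..<1} x) *\<^sub>R x ^ p) \<partial>lborel) = ennreal r"
      using nonneg by (intro nn_integral_has_integral_lborel) (auto simp: indicator_def)
  qed simp
qed (use nonneg in \<open>auto simp: indicator_def\<close>)

lemma scale_unit_density:
  assumes [measurable]: "w \<in> borel_measurable borel" and "0 \<le> c"
  shows "scale_measure (ennreal c) (unit_density w) = unit_density (\<lambda>x. c * w x)"
proof (rule measure_eqI)
  fix A assume "A \<in> sets (scale_measure (ennreal c) (unit_density w))"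
  then have [measurable]: "A \<in> sets borel" by simp
  have "emeasure (unit_density (\<lambda>x. c * w x)) A
      = (\<integral>\<^sup>+x. ennreal c * (ennreal (w x * indicator {0<..<1} x) * indicator A x) \<partial>lborel)"
    using \<open>0 \<le> c\<close> unfolding unit_density_def
    by (subst emeasure_density) (auto simp: ennreal_mult' mult.assoc intro!: nn_integral_cong)
  also have "\<dots> = ennreal c * emeasure (unit_density w) A"
    unfolding unit_density_def by (subst emeasure_density) (auto intro!: nn_integral_cmult)
  finally show "emeasure (scale_measure (ennreal c) (unit_density w)) A
      = emeasure (unit_density (\<lambda>x. c * w x)) A" by simp
qed simp

lemma levy_integral_unit_density:
  assumes [measurable]: "w \<in> borel_measurable borel"
    and nonneg: "\<And>x. 0 < x \<Longrightarrow> x < 1 \<Longrightarrow> 0 \<le> w x"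
    and mom: "\<And>p. ((\<lambda>x. x ^ (p + 2) * w x) has_integral q p) {0<..<1}"
  shows "(CLINT x|unit_density w. iexp (t * x) - 1 - \<i> * of_real (t * x))
      = - (of_real t)\<^sup>2 * levy_series q (of_real t)"
    and "(CLINT x|unit_density w. iexp (t * x) - 1 - \<i> * of_real (t * x * indicator {-1..1} x))
      = - (of_real t)\<^sup>2 * levy_series q (of_real t)"
    and "levy_measure (unit_density w)"
proof -
  have mom': "has_bochner_integral (unit_density w) (\<lambda>x. x ^ (p + 2)) (q p)" for p
    by (rule unit_density_moment[OF assms])
  have int: "integrable (unit_density w) (\<lambda>x. x\<^sup>2)"
    using mom'[of 0] unfolding has_bochner_integral_iff add_0 by blast
  note AE = AE_unit_density[OF assms(1)]
  have [measurable_cong]: "sets (unit_density w) = sets borel" by simp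
  have "(\<lambda>p. LINT x|unit_density w. x ^ (p + 2)) = q"
    using mom' by (auto simp: has_bochner_integral_iff)
  with levy_integral_eq_levy_series[OF sets_unit_density AE int, of t]
  show *: "(CLINT x|unit_density w. iexp (t * x) - 1 - \<i> * of_real (t * x))
      = - (of_real t)\<^sup>2 * levy_series q (of_real t)" by simp
  have "(CLINT x|unit_density w. iexp (t * x) - 1 - \<i> * of_real (t * x * indicator {-1..1} x))
      = (CLINT x|unit_density w. iexp (t * x) - 1 - \<i> * of_real (t * x))"
  proof (rule integral_cong_AE)
    show "AE x in unit_density w. iexp (t * x) - 1 - \<i> * of_real (t * x * indicator {-1..1} x)
        = iexp (t * x) - 1 - \<i> * of_real (t * x)"
      using AE by eventually_elim (simp add: indicator_def)
  qed measurable
  with * show "(CLINT x|unit_density w. iexp (t * x) - 1 - \<i> * of_real (t * x * indicator {-1..1} x))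
      = - (of_real t)\<^sup>2 * levy_series q (of_real t)" by simp
  show "levy_measure (unit_density w)"
    unfolding levy_measure_def
  proof (intro conjI)
    show "emeasure (unit_density w) {0} = 0"
      by (rule AE_iff_measurable[THEN iffD1, OF _ _ AE_mp[OF AE]]) (auto simp: unit_density_def)
    have "(\<integral>\<^sup>+x. ennreal (min 1 (x\<^sup>2)) \<partial>unit_density w) \<le> (\<integral>\<^sup>+x. ennreal (norm (x\<^sup>2)) \<partial>unit_density w)"
      by (intro nn_integral_mono ennreal_leI) auto
    also have "\<dots> < \<infinity>" using int by (simp add: integrable_iff_bounded)
    finally show "(\<integral>\<^sup>+x. ennreal (min 1 (x\<^sup>2)) \<partial>unit_density w) < \<infinity>" .
  qed simp
qed

section \<open>Asymptotics of Beta function ratios\<close>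

text \<open>By log-convexity, the slope of \<open>ln \<circ> Gamma\<close> between \<open>x\<close> and \<open>x + s\<close> lies between its slopes on the unit intervals
  that end at \<open>x\<close> and begin at \<open>x + s\<close>, which the functional equation evaluates to logarithms.\<close>

lemma Gamma_ratio_bounds:
  fixes x s :: real
  assumes "x > 1" "s > 0"
  shows "(x - 1) powr s \<le> Gamma (x + s) / Gamma x" "Gamma (x + s) / Gamma x \<le> (x + s) powr s"
proof -
  let ?f = "ln \<circ> Gamma :: real \<Rightarrow> real"
  have step: "?f (y + 1) - ?f y = ln y" if "y > 0" for y
  proof -
    have "y \<notin> \<int>\<^sub>\<le>\<^sub>0" using that nonpos_Ints_nonpos[of y] by force
    then have "Gamma (y + 1) = y * Gamma y" by (rule Gamma_plus1)
    moreover have "Gamma y \<noteq> 0" using Gamma_real_pos[OF that] by simp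
    ultimately show ?thesis using that by (simp add: ln_mult)
  qed
  have Gpos: "Gamma x > 0" "Gamma (x + s) > 0" using assms by auto
  have eq: "Gamma (x + s) / Gamma x = exp (?f (x + s) - ?f x)"
    using Gpos by (simp add: exp_diff)
  note slope = convex_on_slope_le[OF log_convex_Gamma_real]
  have "(?f (x - 1) - ?f x) / ((x - 1) - x) \<le> (?f (x - 1) - ?f (x + s)) / ((x - 1) - (x + s))"
    by (rule slope(1)) (use assms in auto)
  also have "\<dots> \<le> (?f x - ?f (x + s)) / (x - (x + s))"
    by (rule slope(2)) (use assms in auto)
  finally have "?f x - ?f (x - 1) \<le> (?f (x + s) - ?f x) / s"
    using assms by (simp add: divide_simps)
  with step[of "x - 1"] assms have "ln (x - 1) \<le> (?f (x + s) - ?f x) / s"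
    by simp
  then have "s * ln (x - 1) \<le> ?f (x + s) - ?f x"
    using assms by (simp add: field_simps)
  then show "(x - 1) powr s \<le> Gamma (x + s) / Gamma x"
    unfolding eq using assms by (simp add: powr_def)
  have "(?f x - ?f (x + s)) / (x - (x + s)) \<le> (?f x - ?f (x + s + 1)) / (x - (x + s + 1))"
    by (rule slope(1)) (use assms in auto)
  also have "\<dots> \<le> (?f (x + s) - ?f (x + s + 1)) / ((x + s) - (x + s + 1))"
    by (rule slope(2)) (use assms in auto)
  finally have "(?f (x + s) - ?f x) / s \<le> ?f (x + s + 1) - ?f (x + s)"
    using assms by (simp add: divide_simps)
  with step[of "x + s"] assms have "(?f (x + s) - ?f x) / s \<le> ln (x + s)"
    by simp
  then have "?f (x + s) - ?f x \<le> s * ln (x + s)"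
    using assms by (simp add: field_simps)
  then show "Gamma (x + s) / Gamma x \<le> (x + s) powr s"
    unfolding eq using assms by (simp add: powr_def)
qed

lemma Gamma_ratio_asymp:
  fixes s :: real
  assumes "s > 0"
  shows "((\<lambda>y. Gamma y / (Gamma (y - s) * y powr s)) \<longlongrightarrow> 1) at_top"
proof (rule tendsto_sandwich)
  show "((\<lambda>y. ((y - s - 1) / y) powr s) \<longlongrightarrow> 1) at_top"
    using assms by real_asymp
  show "\<forall>\<^sub>F y in at_top. ((y - s - 1) / y) powr s \<le> Gamma y / (Gamma (y - s) * y powr s)"
    using eventually_gt_at_top[of "s + 1"]
  proof eventually_elim
    case (elim y)
    then show ?case
      using Gamma_ratio_bounds(1)[of "y - s" s] assms
      by (simp add: powr_divide divide_right_mono flip: divide_divide_eq_left)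
  qed
  show "\<forall>\<^sub>F y in at_top. Gamma y / (Gamma (y - s) * y powr s) \<le> 1"
    using eventually_gt_at_top[of "s + 1"]
  proof eventually_elim
    case (elim y)
    then show ?case
      using Gamma_ratio_bounds(2)[of "y - s" s] assms
      by (simp add: flip: divide_divide_eq_left)
  qed
qed simp

text \<open>For \<open>0 < s < L\<close> this is the moment of order \<open>p\<close> of \<open>U\<^sup>L\<close>, where \<open>U\<close> has the Beta distribution with parameters
  \<open>L - s\<close> and \<open>s\<close>.\<close>

definition beta_moment :: "real \<Rightarrow> real \<Rightarrow> nat \<Rightarrow> real" where
  "beta_moment L s p = Beta ((real p + 1) * L - s) s / Beta (L - s) s"

lemma Beta_real_pos: "a > 0 \<Longrightarrow> b > 0 \<Longrightarrow> Beta a b > 0" for a b :: real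
  by (simp add: Beta_def)

lemma beta_moment_0: "0 < s \<Longrightarrow> s < L \<Longrightarrow> beta_moment L s 0 = 1"
  using Beta_real_pos[of "L - s" s] by (simp add: beta_moment_def)

lemma beta_moment_bounds:
  assumes "0 < s" "s < L"
  shows "0 \<le> beta_moment L s p" "beta_moment L s p \<le> 1"
    and "1 \<le> p \<Longrightarrow> beta_moment L s p \<le> beta_moment L s 1"
proof -
  have ge: "L - s \<le> (real p + 1) * L - s" using assms by (simp add: algebra_simps)
  have pos: "Beta (L - s) s > 0" "Beta ((real p + 1) * L - s) s > 0"
    using assms ge by (intro Beta_real_pos; linarith)+
  show "0 \<le> beta_moment L s p" using pos by (simp add: beta_moment_def)
  have "Beta ((real p + 1) * L - s) s \<le> Beta (L - s) s"
    using assms ge by (intro Beta_real_mono) auto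
  then show "beta_moment L s p \<le> 1" using pos by (simp add: beta_moment_def)
  assume "1 \<le> p"
  then have "1 * L \<le> real p * L" using assms by (intro mult_right_mono) auto
  then have "2 * L - s \<le> (real p + 1) * L - s" by (simp add: algebra_simps)
  then have "Beta ((real p + 1) * L - s) s \<le> Beta (2 * L - s) s"
    using assms by (intro Beta_real_mono) auto
  then show "beta_moment L s p \<le> beta_moment L s 1"
    using pos unfolding beta_moment_def by (intro divide_right_mono) auto
qed

text \<open>The factor \<open>Gamma s\<close> cancels, and what remains are two ratios \<open>Gamma y / Gamma (y - s)\<close>, at \<open>y = L\<close> and at
  \<open>y = (p + 1) L\<close>, each asymptotic to \<open>y\<^sup>s\<close>.\<close>

lemma tendsto_beta_moment_fixed:
  assumes s: "0 < s" and L: "filterlim L at_top F" and sL: "\<And>n. s < L n"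
  shows "((\<lambda>n. beta_moment (L n) s p) \<longlongrightarrow> (real p + 1) powr (- s)) F"
proof -
  define R where "R y = Gamma y / (Gamma (y - s) * y powr s)" for y
  have R1: "((\<lambda>n. R (L n)) \<longlongrightarrow> 1) F"
    unfolding R_def by (rule filterlim_compose[OF Gamma_ratio_asymp[OF s] L])
  have "filterlim (\<lambda>n. (real p + 1) * L n) at_top F"
    by (rule filterlim_tendsto_pos_mult_at_top[OF tendsto_const _ L]) simp
  then have R2: "((\<lambda>n. R ((real p + 1) * L n)) \<longlongrightarrow> 1) F"
    unfolding R_def by (rule filterlim_compose[OF Gamma_ratio_asymp[OF s]])
  have "((\<lambda>n. R (L n) / R ((real p + 1) * L n) * (real p + 1) powr (- s))
      \<longlongrightarrow> 1 / 1 * (real p + 1) powr (- s)) F"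
    by (intro tendsto_intros R1 R2) simp
  moreover have "R (L n) / R ((real p + 1) * L n) * (real p + 1) powr (- s) = beta_moment (L n) s p" for n
  proof -
    define y where "y = (real p + 1) * L n"
    have yL: "L n \<le> y" using s sL[of n] by (simp add: y_def algebra_simps)
    then have pos: "Gamma (L n) > 0" "Gamma (L n - s) > 0" "Gamma y > 0" "Gamma (y - s) > 0"
        "Gamma s > 0" "L n powr s > 0"
      using s sL[of n] by auto
    have "y powr s = (real p + 1) powr s * L n powr s"
      using s sL[of n] by (simp add: y_def powr_mult)
    moreover have "beta_moment (L n) s p = (Gamma (y - s) / Gamma y) / (Gamma (L n - s) / Gamma (L n))"
      using pos by (simp add: beta_moment_def Beta_def flip: y_def)
    moreover have "a / (b * l) / (c / (d * (P * l))) * inverse P = (d / c) / (b / a)"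
      if "0 < a" "0 < b" "0 < c" "0 < d" "0 < l" "0 < P" for a b c d l P :: real
      using that by (simp add: field_simps)
    ultimately show ?thesis
      using pos by (simp add: R_def powr_minus flip: y_def)
  qed
  ultimately show ?thesis by simp
qed

text \<open>Each unit step multiplies the Beta function by \<open>x / (x + s)\<close>, where \<open>x\<close> is the current first argument.\<close>

lemma Beta_shift_le:
  fixes \<alpha> s c :: real
  assumes "\<alpha> > 0" "s > 0" "\<alpha> + real j \<le> c"
  shows "Beta (\<alpha> + real j) s \<le> (c / (c + s)) ^ j * Beta \<alpha> s"
  using assms(3)
proof (induction j)
  case (Suc j)
  have x: "\<alpha> + real j > 0" using assms by (simp add: add_pos_nonneg)
  then have "(\<alpha> + real j + s) * Beta (\<alpha> + real j + 1) s = (\<alpha> + real j) * Beta (\<alpha> + real j) s"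
    by (intro Beta_plus1_left) (auto dest: nonpos_Ints_nonpos)
  then have "Beta (\<alpha> + real (Suc j)) s = (\<alpha> + real j) / (\<alpha> + real j + s) * Beta (\<alpha> + real j) s"
    using x assms by (simp add: field_simps)
  also have "\<dots> \<le> c / (c + s) * ((c / (c + s)) ^ j * Beta \<alpha> s)"
  proof (rule mult_mono)
    show "(\<alpha> + real j) / (\<alpha> + real j + s) \<le> c / (c + s)"
    proof -
      have "(\<alpha> + real j) * s \<le> c * s" using assms Suc.prems by (intro mult_right_mono) auto
      then have "(\<alpha> + real j) * (c + s) \<le> c * (\<alpha> + real j + s)" by (simp add: algebra_simps)
      then show ?thesis using x assms Suc.prems by (simp add: pos_divide_le_eq pos_le_divide_eq)
    qed
    show "Beta (\<alpha> + real j) s \<le> (c / (c + s)) ^ j * Beta \<alpha> s"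
      using Suc by simp
    show "0 \<le> Beta (\<alpha> + real j) s" using Beta_real_pos[OF x assms(2)] by simp
  qed (use x assms Suc.prems in auto)
  finally show ?case by (simp add: mult_ac)
qed auto

text \<open>Going from \<open>L - s\<close> to \<open>2 L - s\<close> takes about \<open>L\<close> unit steps, each of which contributes a factor at most
  \<open>(2 L - s) / (2 L) \<le> exp (- s / (2 L))\<close>. The number of complete steps is at least \<open>L / 2\<close>, whence the constant \<open>4\<close>.\<close>

lemma beta_moment_1_le:
  assumes "0 < s" "s < L" "1 \<le> L"
  shows "beta_moment L s 1 \<le> exp (- s / 4)"
proof -
  define j where "j = nat \<lfloor>L\<rfloor>"
  have j: "real j \<le> L" "L / 2 \<le> real j" 
  proof -
    have "1 \<le> \<lfloor>L\<rfloor>" using assms by simp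
    then have "real j = of_int \<lfloor>L\<rfloor>" "1 \<le> real j" by (auto simp: j_def)
    then show "real j \<le> L" "L / 2 \<le> real j" by linarith+
  qed
  have "Beta (2 * L - s) s \<le> Beta (L - s + real j) s"
    using assms j by (intro Beta_real_mono) auto
  also have "\<dots> \<le> ((2 * L - s) / (2 * L - s + s)) ^ j * Beta (L - s) s"
    using assms j by (intro Beta_shift_le) auto
  finally have "beta_moment L s 1 \<le> ((2 * L - s) / (2 * L)) ^ j"
    using Beta_real_pos[of "L - s" s] assms
    by (simp add: beta_moment_def divide_le_eq)
  also have "(2 * L - s) / (2 * L) = 1 + (- (s / (2 * L)))"
    using assms by (simp add: field_simps)
  also have "(1 + (- (s / (2 * L)))) ^ j \<le> exp (- (s / (2 * L))) ^ j"
    using assms by (intro power_mono exp_ge_add_one_self) (auto simp: field_simps)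
  also have "\<dots> = exp (- (s / (2 * L) * real j))"
    by (simp add: exp_of_nat_mult[symmetric] mult_ac)
  also have "\<dots> \<le> exp (- (s / (2 * L) * (L / 2)))"
    using assms j by (intro exp_le_cancel_iff[THEN iffD2] le_imp_neg_le mult_left_mono) auto
  also have "s / (2 * L) * (L / 2) = s / 4" using assms by simp
  finally show ?thesis by simp
qed

lemma tendsto_beta_moment_gaussian:
  assumes s: "filterlim s at_top F" "\<And>n. 0 < s n" and L: "\<And>n. s n < L n" "\<And>n. 1 \<le> L n"
  shows "((\<lambda>n. beta_moment (L n) (s n) p) \<longlongrightarrow> (if p = 0 then 1 else 0)) F"
proof (cases "p = 0")
  case True
  then show ?thesis using s L by (simp add: beta_moment_0)
next
  case False
  have le: "beta_moment (L n) (s n) p \<le> exp (- s n / 4)" for n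
  proof -
    have "beta_moment (L n) (s n) p \<le> beta_moment (L n) (s n) 1"
      using False by (intro beta_moment_bounds(3) s(2) L(1)) simp
    also have "\<dots> \<le> exp (- s n / 4)"
      by (rule beta_moment_1_le[OF s(2) L])
    finally show ?thesis .
  qed
  have "((\<lambda>n. beta_moment (L n) (s n) p) \<longlongrightarrow> 0) F"
  proof (rule tendsto_sandwich[where f = "\<lambda>_. 0" and h = "\<lambda>n. exp (- s n / 4)"])
    show "((\<lambda>n. exp (- s n / 4)) \<longlongrightarrow> 0) F"
      by (rule filterlim_compose[OF _ s(1)]) real_asymp
    show "\<forall>\<^sub>F n in F. beta_moment (L n) (s n) p \<le> exp (- s n / 4)"
      using le by simp
    show "\<forall>\<^sub>F n in F. 0 \<le> beta_moment (L n) (s n) p"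
      using beta_moment_bounds(1)[OF s(2) L(1)] by simp
  qed simp
  with False show ?thesis by simp
qed

section \<open>Moments of the Levy measures and of their limit\<close>

definition nu_weight :: "nat \<Rightarrow> nat \<Rightarrow> real \<Rightarrow> real" where
  "nu_weight d k x = omega (d - k) / (real k - 1) * x powr (- 1 - (real d - 1) / (real k - 1)) *
     (1 - x powr (2 / (real k - 1))) powr ((real d - real k) / 2 - 1)"

lemma nu_eq: "nu d k = unit_density (nu_weight d k)"
  by (simp add: nu_def unit_density_def nu_weight_def)

lemma measurable_nu_weight [measurable]: "nu_weight d k \<in> borel_measurable borel"
  unfolding nu_weight_def[abs_def] by measurable

lemma omega_pos: "b \<ge> 1 \<Longrightarrow> omega b > 0"
  by (simp add: omega_def)

lemma nu_weight_nonneg: "k \<ge> 1 \<Longrightarrow> k < d \<Longrightarrow> 0 \<le> nu_weight d k x"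
  unfolding nu_weight_def
  by (intro mult_nonneg_nonneg divide_nonneg_nonneg less_imp_le[OF omega_pos]) auto

text \<open>In terms of \<open>L\<close> and \<open>s\<close>, the power \<open>x\<^bsup>p+2\<^esup>\<close> times the density is
  \<open>x powr (\<alpha> / L - 1) * (1 - x powr (1 / L)) powr (s - 1)\<close> up to a constant, with \<open>\<alpha> = (p + 1) L - s\<close>.
  The condition \<open>2 k > d + 1\<close> says that \<open>s < L\<close>, so that \<open>\<alpha> > 0\<close> for all \<open>p\<close>.\<close>

lemma nu_weight_moment:
  fixes d k p :: nat
  defines "L \<equiv> (real k - 1) / 2" and "s \<equiv> (real d - real k) / 2"
  assumes "k < d" "2 * k > d + 1"
  shows "((\<lambda>x. x ^ (p + 2) * nu_weight d k x) has_integral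
     omega (d - k) / 2 * Beta ((real p + 1) * L - s) s) {0<..<1}"
proof -
  have sL: "0 < s" "s < L" "1 \<le> L" using assms(3,4) by (auto simp: L_def s_def)
  define \<alpha> where "\<alpha> = (real p + 1) * L - s"
  have "1 * L \<le> (real p + 1) * L" using sL by (intro mult_right_mono) auto
  then have \<alpha>: "\<alpha> > 0" using sL unfolding \<alpha>_def by linarith
  have k: "real k - 1 = 2 * L" "(real d - 1) / (real k - 1) = (s + L) / L"
    using sL by (auto simp: L_def s_def field_simps)
  have int: "((\<lambda>x. omega (d - k) / (2 * L) * (x powr (\<alpha> / L - 1) * (1 - x powr (1 / L)) powr (s - 1)))
      has_integral omega (d - k) / (2 * L) * (L * Beta \<alpha> s)) {0<..<1}"
    using has_integral_Beta_root[of \<alpha> s L] \<alpha> sL by (intro has_integral_mult_right) auto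
  have val: "omega (d - k) / (2 * L) * (L * Beta \<alpha> s) = omega (d - k) / 2 * Beta \<alpha> s"
    using sL by simp
  have eq: "omega (d - k) / (2 * L) * (x powr (\<alpha> / L - 1) * (1 - x powr (1 / L)) powr (s - 1))
      = x ^ (p + 2) * nu_weight d k x" if "x \<in> {0<..<1}" for x
  proof -
    have "x powr (\<alpha> / L - 1) = x powr (real (p + 2)) * x powr (- 1 - (s + L) / L)"
      using sL by (simp flip: powr_add add: \<alpha>_def field_simps)
    also have "x powr (real (p + 2)) = x ^ (p + 2)"
      using that by (intro powr_realpow) auto
    finally show ?thesis
      unfolding nu_weight_def k(2) unfolding k(1) by (simp add: s_def[symmetric] mult_ac)
  qed
  show ?thesis
    using has_integral_eq[OF eq int] unfolding val \<alpha>_def[symmetric] .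
qed

definition nu_lim_weight :: "nat \<Rightarrow> real \<Rightarrow> real" where
  "nu_lim_weight b x = 1 / Gamma (real b / 2) * x powr (- 2) * (- ln x) powr ((real b - 2) / 2)"

lemma nu_lim_eq: "nu_lim b = unit_density (nu_lim_weight b)"
  by (simp add: nu_lim_def unit_density_def nu_lim_weight_def)

lemma measurable_nu_lim_weight [measurable]: "nu_lim_weight b \<in> borel_measurable borel"
  unfolding nu_lim_weight_def[abs_def] by measurable

lemma nu_lim_weight_nonneg: "b \<ge> 1 \<Longrightarrow> 0 \<le> nu_lim_weight b x"
  by (simp add: nu_lim_weight_def less_imp_le)

lemma nu_lim_weight_moment:
  assumes "b \<ge> 1"
  shows "((\<lambda>x. x ^ (p + 2) * nu_lim_weight b x) has_integral (real p + 1) powr (- (real b / 2))) {0<..<1}"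
proof -
  define s where "s = real b / 2"
  have s: "s > 0" "(real b - 2) / 2 = s - 1" using assms by (auto simp: s_def)
  have int: "((\<lambda>x. 1 / Gamma s * (x powr (real p + 1 - 1) * (- ln x) powr (s - 1)))
      has_integral 1 / Gamma s * (Gamma s * (real p + 1) powr (- s))) {0<..<1}"
    using has_integral_Gamma_log[of s "real p + 1"] s by (intro has_integral_mult_right) auto
  have val: "1 / Gamma s * (Gamma s * (real p + 1) powr (- s)) = (real p + 1) powr (- s)"
    using Gamma_real_pos[OF s(1)] by simp
  have eq: "1 / Gamma s * (x powr (real p + 1 - 1) * (- ln x) powr (s - 1))
      = x ^ (p + 2) * nu_lim_weight b x" if "x \<in> {0<..<1}" for x
  proof -
    have "x powr (real p + 1 - 1) = x powr (real (p + 2)) * x powr (- 2)"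
      by (simp flip: powr_add)
    also have "x powr (real (p + 2)) = x ^ (p + 2)"
      using that by (intro powr_realpow) auto
    finally show ?thesis
      by (simp add: nu_lim_weight_def s(2) s_def[symmetric] mult_ac)
  qed
  show ?thesis
    using has_integral_eq[OF eq int] unfolding val s_def[symmetric] .
qed

section \<open>The limit theorem\<close>

lemma law_variance_of_levy_series:
  assumes "real_distribution M"
    and "\<And>t. char M t = exp (- (of_real t)\<^sup>2 * levy_series q (of_real t))" "\<And>p. \<bar>q p\<bar> \<le> C"
  shows "law_variance M = q 0"
proof -
  interpret real_distribution M by fact
  show ?thesis
    using moments_of_levy_series(2,3)[OF assms(2,3)] by (simp add: law_variance_def)
qed

text \<open>The variance is the second moment of the Levy measure, that is, \<open>q 0\<close> in \<open>moments_of_levy_series\<close>.\<close>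

lemma law_variance_Z:
  fixes d k :: nat
  defines "L \<equiv> (real k - 1) / 2" and "s \<equiv> (real d - real k) / 2"
  assumes "k < d" "2 * k > d + 1" "is_law_Z d k M"
  shows "law_variance M = omega (d - k) / 2 * Beta (L - s) s"
proof -
  have sL: "0 < s" "s < L" using assms(3,4) by (auto simp: L_def s_def)
  let ?q = "\<lambda>p. omega (d - k) / 2 * Beta ((real p + 1) * L - s) s"
  have "law_variance M = ?q 0"
  proof (rule law_variance_of_levy_series)
    have "\<And>x. 0 \<le> nu_weight d k x" using assms(3,4) by (intro nu_weight_nonneg) auto
    then show "char M t = exp (- (of_real t)\<^sup>2 * levy_series ?q (of_real t))" for t
      using assms(5) levy_integral_unit_density(1)[OF measurable_nu_weight _ nu_weight_moment[OF assms(3,4)]]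
      unfolding L_def s_def by (simp add: is_law_Z_def nu_eq)
    have om: "omega (d - k) > 0" using assms(3) by (intro omega_pos) simp
    show "\<bar>?q p\<bar> \<le> omega (d - k) / 2 * Beta (L - s) s" for p
    proof -
      have "1 * L \<le> (real p + 1) * L" using sL by (intro mult_right_mono) auto
      then have "0 < (real p + 1) * L - s" "L - s \<le> (real p + 1) * L - s" using sL by linarith+
      moreover from this have "0 < Beta ((real p + 1) * L - s) s"
        by (intro Beta_real_pos sL)
      ultimately have "Beta ((real p + 1) * L - s) s \<le> Beta (L - s) s" "0 < Beta ((real p + 1) * L - s) s"
        using sL by (simp_all add: Beta_real_mono)
      with om show ?thesis by (simp add: abs_mult mult_left_mono)
    qed
  qed (use assms(5) in \<open>simp add: is_law_Z_def\<close>)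
  then show ?thesis by simp
qed

text \<open>Dividing the Levy measure by the variance divides each moment of \<open>x\<^sup>2 \<nu>(dx)\<close> by the one of order \<open>0\<close>; the factor
  \<open>omega (d - k) / 2\<close> cancels.\<close>

lemma char_normalized_Z:
  fixes d k :: nat
  defines "L \<equiv> (real k - 1) / 2" and "s \<equiv> (real d - real k) / 2"
  assumes "k < d" "2 * k > d + 1" "is_law_Z d k M"
    and M': "has_levy_triplet M' 0 0 (scale_measure (ennreal (1 / law_variance M)) (nu d k))"
  shows "char M' t = exp (- (of_real t)\<^sup>2 * levy_series (beta_moment L s) (of_real t))"
proof -
  have sL: "0 < s" "s < L" using assms(3,4) by (auto simp: L_def s_def)
  define v where "v = omega (d - k) / 2 * Beta (L - s) s"
  have om: "omega (d - k) > 0" using assms(3) by (intro omega_pos) simp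
  have v: "v > 0" using om Beta_real_pos[of "L - s" s] sL by (simp add: v_def)
  have "law_variance M = v"
    using law_variance_Z[OF assms(3-5)] by (simp add: v_def L_def s_def)
  then have scaled: "scale_measure (ennreal (1 / law_variance M)) (nu d k)
      = unit_density (\<lambda>x. 1 / v * nu_weight d k x)"
    using v by (simp add: nu_eq scale_unit_density[OF measurable_nu_weight])
  have mom: "((\<lambda>x. x ^ (p + 2) * (1 / v * nu_weight d k x)) has_integral beta_moment L s p) {0<..<1}" for p
  proof -
    have "beta_moment L s p = 1 / v * (omega (d - k) / 2 * Beta ((real p + 1) * L - s) s)"
      using om by (simp add: v_def beta_moment_def)
    then show ?thesis
      using has_integral_mult_right[OF nu_weight_moment[OF assms(3,4), of p], of "1 / v"]
      unfolding L_def s_def by (simp add: mult_ac)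
  qed
  have nonneg: "0 \<le> 1 / v * nu_weight d k x" for x
    using v nu_weight_nonneg[of k d x] assms(3,4) by simp
  show ?thesis
    using M' levy_integral_unit_density(2)[OF _ nonneg mom]
    unfolding has_levy_triplet_def scaled by simp
qed

lemma char_std_normal_levy_series:
  "char std_normal_distribution t
    = exp (- (of_real t)\<^sup>2 * levy_series (\<lambda>p. if p = 0 then 1 else 0) (of_real t))"
proof -
  have "levy_series (\<lambda>p. if p = 0 then 1 else 0) z = 1 / 2" for z
    unfolding levy_series_def by (subst suminf_finite[of "{0}"]) (auto simp: numeral_2_eq_2)
  then show ?thesis
    by (simp only: char_std_normal_distribution exp_of_real[symmetric]) simp
qed

theorem theorem3:
  fixes d k :: "nat \<Rightarrow> nat" and Z Zt :: "nat \<Rightarrow> real measure"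
  assumes "\<And>n. 1 \<le> k n" and "\<And>n. k n < d n" and "\<And>n. 2 * k n > d n + 1"
    and "filterlim d at_top sequentially"
    and "\<And>n. is_law_Z (d n) (k n) (Z n)"
    and "\<And>n. has_levy_triplet (Zt n) 0 0
           (scale_measure (ennreal (1 / law_variance (Z n))) (nu (d n) (k n)))"
  shows "(\<forall>b. (\<forall>n. d n - k n = b) \<longrightarrow>
            (\<exists>N. has_levy_triplet N 0 0 (nu_lim b) \<and> weak_conv_m Zt N \<and>
                 (\<forall>m::nat. integrable N (\<lambda>x. x ^ m)) \<and> law_variance N = 1)) \<and>
         (filterlim (\<lambda>n. d n - k n) at_top sequentially \<longrightarrow>
            weak_conv_m Zt std_normal_distribution)"
proof -
  define L s where "L n = (real (k n) - 1) / 2" and "s n = (real (d n) - real (k n)) / 2" for n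
  have sL: "0 < s n" "s n < L n" "1 \<le> L n" for n
    using assms(2,3)[of n] by (auto simp: L_def s_def)
  have s_diff: "s n = real (d n - k n) / 2" for n
    using assms(2)[of n] by (simp add: s_def of_nat_diff)
  define Q where "Q n = beta_moment (L n) (s n)" for n
  have Q: "\<bar>Q n p\<bar> \<le> 1" for n p
    using beta_moment_bounds(1,2)[OF sL(1,2)] by (simp add: Q_def)
  have Q0: "Q n 0 = 1" for n
    using beta_moment_0[OF sL(1,2)] by (simp add: Q_def)
  have rd: "real_distribution (Zt n)" and ID: "infinitely_divisible (Zt n)" for n
    using assms(6)[of n] by (auto simp: has_levy_triplet_def)
  have char: "char (Zt n) t = exp (- (of_real t)\<^sup>2 * levy_series (Q n) (of_real t))" for n t
    using char_normalized_Z[OF assms(2,3,5,6)] by (simp add: Q_def L_def s_def)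
  have tight: "tight Zt"
  proof (rule tight_of_second_moments[OF rd])
    fix n
    interpret real_distribution "Zt n" by (rule rd)
    show "integrable (Zt n) (\<lambda>x. x\<^sup>2)" by (rule moments_of_levy_series(1)[OF char Q])
    show "(LINT x|Zt n. x\<^sup>2) \<le> 1"
      using moments_of_levy_series(3)[OF char Q] Q0 by simp
  qed
  have lim: "(\<lambda>n. char (Zt n) t) \<longlonglongrightarrow> exp (- (of_real t)\<^sup>2 * levy_series q (of_real t))"
    if "\<And>p. (\<lambda>n. Q n p) \<longlonglongrightarrow> q p" for q t
    unfolding char by (intro tendsto_intros tendsto_levy_series[OF that Q])
  show ?thesis
  proof (intro conjI allI impI)
    fix b assume "\<forall>n. d n - k n = b"
    then have db: "d n = k n + b" for n
      using assms(2)[of n] by (auto dest: spec[of _ n])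
    then have b: "b \<ge> 1" "\<And>n. s n = real b / 2"
      using assms(2)[of 0] by (simp_all add: s_def)
    have "filterlim (\<lambda>n. real (d n)) at_top sequentially"
      by (rule filterlim_compose[OF filterlim_real_sequentially assms(4)])
    then have "filterlim (\<lambda>n. (1 / 2) * ((- real b - 1) + real (d n))) at_top sequentially"
      by (intro filterlim_tendsto_pos_mult_at_top[OF tendsto_const]
          filterlim_tendsto_add_at_top[OF tendsto_const]) auto
    \<comment> \<open>Fixing the codimension \<open>b\<close> makes \<open>L = (d - b - 1) / 2\<close>, so \<open>L\<close> tends to infinity with \<open>d\<close>.\<close>
    moreover have "(1 / 2) * ((- real b - 1) + real (d n)) = L n" for n
      by (simp add: L_def db)
    ultimately have "filterlim L at_top sequentially" by simp
    define q where "q p = (real p + 1) powr (- (real b / 2))" for p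
    have q: "(\<lambda>n. Q n p) \<longlonglongrightarrow> q p" for p
      unfolding Q_def q_def b(2)
      by (rule tendsto_beta_moment_fixed[OF _ \<open>filterlim L at_top sequentially\<close>])
         (use sL b in auto)
    have q_le: "\<bar>q p\<bar> \<le> 1" for p
      using q Q by (intro LIMSEQ_le_const2[OF tendsto_rabs[OF q]]) auto
    from tight_char_limit_is_char[OF tight lim[OF q]]
    obtain N where N: "real_distribution N"
      and char_N: "char N t = exp (- (of_real t)\<^sup>2 * levy_series q (of_real t))" for t
      by metis
    interpret N: real_distribution N by (rule N)
    have lim_N: "(\<lambda>n. char (Zt n) t) \<longlonglongrightarrow> char N t" for t
      unfolding char_N by (rule lim[OF q])
    show "\<exists>N. has_levy_triplet N 0 0 (nu_lim b) \<and> weak_conv_m Zt N \<and>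
        (\<forall>m::nat. integrable N (\<lambda>x. x ^ m)) \<and> law_variance N = 1"
    proof (intro exI[of _ N] conjI allI)
      note nu_lim_integral = levy_integral_unit_density(2,3)[OF measurable_nu_lim_weight
          nu_lim_weight_nonneg[OF b(1)] nu_lim_weight_moment[OF b(1)],
          folded nu_lim_eq q_def[abs_def]]
      show "has_levy_triplet N 0 0 (nu_lim b)"
        unfolding has_levy_triplet_def
        using N infinitely_divisible_limit[OF tight ID N lim_N] nu_lim_integral char_N by simp
      show "weak_conv_m Zt N" by (rule levy_continuity[OF rd N lim_N])
      show "integrable N (\<lambda>x. x ^ m)" for m by (rule N.moments_of_levy_series(1)[OF char_N q_le])
      show "law_variance N = 1"
        using law_variance_of_levy_series[OF N char_N q_le] by (simp add: q_def)
    qed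
  next
    assume "filterlim (\<lambda>n. d n - k n) at_top sequentially"
    then have "filterlim (\<lambda>n. real (d n - k n)) at_top sequentially"
      by (rule filterlim_compose[OF filterlim_real_sequentially])
    then have "filterlim (\<lambda>n. (1 / 2) * real (d n - k n)) at_top sequentially"
      by (intro filterlim_tendsto_pos_mult_at_top[OF tendsto_const]) auto
    moreover have "s = (\<lambda>n. (1 / 2) * real (d n - k n))" by (simp add: fun_eq_iff s_diff)
    ultimately have "filterlim s at_top sequentially" by simp
    then have "(\<lambda>n. Q n p) \<longlonglongrightarrow> (if p = 0 then 1 else 0)" for p
      unfolding Q_def by (rule tendsto_beta_moment_gaussian[OF _ sL])
    from lim[OF this] show "weak_conv_m Zt std_normal_distribution"
      by (intro levy_continuity[OF rd real_dist_normal_dist]) (simp add: char_std_normal_levy_series)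
  qed
qed

end
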